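(* Let $r$ be a positive integer such that $r+1$ is a prime that is not a Mersenne prime (i.e. $r+2$ is not a power of $2$). Suppose there exist a positive integer $N$ and distinct primes $p_1,p_2$ with $\operatorname{ord}_{p_1}(r+1)=\operatorname{ord}_{p_2}(r+1)=2^N$. Then there are infinitely many primes $p$ such that $(r+1)^{\alpha}p\in G_r$ for all nonnegative integers $\alpha$.
   Context: For a positive integer $r$, the $r$-th Schemmel totient function $S_r:\mathbb{N}\to\mathbb{N}_0$ is the multiplicative arithmetic function (so $S_r(1)=1$ and $S_r(ab)=S_r(a)S_r(b)$ for coprime $a,b$) defined on prime powers by $S_r(p^{\alpha})=0$ if $p\le r$ and $S_r(p^\alpha)=p^{\alpha-1}(p-r)$ if $p>r$, for all primes $p$ and positive integers $\alpha$. $G_r$ denotes the set of positive integers not in the range of $S_r$. $\operatorname{ord}_q(a)$ denotes the multiplicative order of $a$ modulo the prime $q$. *)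

theory Defs
  imports "HOL-Number_Theory.Number_Theory"
begin

definition schemmel :: "nat \<Rightarrow> nat \<Rightarrow> nat" where
  "schemmel r n = (\<Prod>p\<in>prime_factors n.
      (if p \<le> r then 0 else p ^ (multiplicity p n - 1) * (p - r)))"

definition G :: "nat \<Rightarrow> nat set" where
  "G r = {m. m > 0 \<and> m \<notin> schemmel r ` {n. n > 0}}"

end

theory Submission
  imports Defs "HOL-Computational_Algebra.Squarefree"
begin

text \<open>
  Write \<open>q = r + 1\<close>. If \<open>S\<^sub>r(n) = q\<^sup>\<alpha> p\<close> for a prime \<open>p > q\<close>, then looking at the prime power of \<open>n\<close>
  that contributes the factor \<open>p\<close> shows that \<open>q\<^sup>j p + r\<close> is prime for some \<open>j\<close>, or that
  \<open>p = q\<^sup>j + r\<close>. Both are excluded by a covering congruence in the style of Erdos: there are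
  primes modulo which \<open>q\<close> has order \<open>2, 4, \<dots>, 2\<^sup>N\<close>, and a second one of order \<open>2\<^sup>N\<close>; since the classes
  \<open>2\<^sup>i\<close> mod \<open>2\<^bsup>i+1\<^esup>\<close> for \<open>i < N\<close> and \<open>0\<close> mod \<open>2\<^sup>N\<close> cover the integers, one can prescribe \<open>p\<close> modulo these
  primes such that every \<open>q\<^sup>j p + r\<close> is divisible by one of them. The prime of order \<open>2\<close> divides
  \<open>q + 1\<close>, and this rules out \<open>p = q\<^sup>j + r\<close>.

  Such primes \<open>p\<close> exist by Dirichlet's theorem for a squarefree modulus, which follows from the
  estimates of \<open>\<Sum>\<^bsub>n\<le>x\<^esub> \<chi>(n)\<Lambda>(n)/n\<close>: it is \<open>ln x + O(1)\<close>, \<open>O(1)\<close> or \<open>- ln x + O(1)\<close> according to whether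
  \<open>\<chi>\<close> is principal, \<open>L(1,\<chi>) \<noteq> 0\<close> or \<open>L(1,\<chi>) = 0\<close>. As \<open>\<Lambda> \<ge> 0\<close>, at most one \<open>\<chi>\<close> has
  \<open>L(1,\<chi>) = 0\<close>; this \<open>\<chi>\<close> would be real, which is impossible by Monsky's argument with the Lambert
  series \<open>\<Sum> \<chi>(n) t\<^sup>n / (1 - t\<^sup>n)\<close> as \<open>t \<rightarrow> 1\<close>.
\<close>

section \<open>Dirichlet characters\<close>

text \<open>Characters of the unit group modulo \<open>M\<close>, extended by zero and viewed as
  periodic functions on all naturals. The value at 1 is a nonzero idempotent, hence 1.\<close>

definition dchars :: "nat \<Rightarrow> (nat \<Rightarrow> complex) set" where
  "dchars M = {\<chi>. (\<forall>m n. \<chi> (m * n) = \<chi> m * \<chi> n) \<and>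
     (\<forall>n. \<chi> n \<noteq> 0 \<longleftrightarrow> coprime n M) \<and> (\<forall>n. \<chi> (n mod M) = \<chi> n)}"

definition principal_char :: "nat \<Rightarrow> nat \<Rightarrow> complex" where
  "principal_char M n = of_bool (coprime n M)"

lemma dchars_mult: "\<chi> \<in> dchars M \<Longrightarrow> \<chi> (m * n) = \<chi> m * \<chi> n"
  by (simp add: dchars_def)

lemma dchars_eq_0_iff: "\<chi> \<in> dchars M \<Longrightarrow> \<chi> n = 0 \<longleftrightarrow> \<not> coprime n M"
  unfolding dchars_def by blast

lemma dchars_mod: "\<chi> \<in> dchars M \<Longrightarrow> \<chi> (n mod M) = \<chi> n"
  by (simp add: dchars_def)

lemma dchars_cong: "\<chi> \<in> dchars M \<Longrightarrow> [m = n] (mod M) \<Longrightarrow> \<chi> m = \<chi> n"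
  by (metis cong_def dchars_mod)

lemma dchars_1: "\<chi> \<in> dchars M \<Longrightarrow> \<chi> 1 = 1"
  using dchars_mult[of \<chi> M 1 1] dchars_eq_0_iff[of \<chi> M 1] by simp

lemma dchars_Suc_0: "\<chi> \<in> dchars M \<Longrightarrow> \<chi> (Suc 0) = 1"
  using dchars_1 by simp

lemma dchars_power: "\<chi> \<in> dchars M \<Longrightarrow> \<chi> (n ^ k) = \<chi> n ^ k"
  by (induction k) (simp_all add: dchars_mult dchars_Suc_0)

lemma dchars_root_unity:
  assumes "\<chi> \<in> dchars M" "coprime n M"
  shows "\<chi> n ^ totient M = 1"
proof -
  have "[n ^ totient M = 1] (mod M)"
    using euler_theorem assms(2) by simp
  then show ?thesis
    using dchars_cong[OF assms(1)] dchars_power[OF assms(1)] dchars_1[OF assms(1)] by metis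
qed

lemma norm_dchars:
  assumes "\<chi> \<in> dchars M" "M > 0" "coprime n M"
  shows "norm (\<chi> n) = 1"
proof -
  have "norm (\<chi> n) ^ totient M = 1"
    using dchars_root_unity[OF assms(1,3)] by (metis norm_one norm_power)
  then show ?thesis
    using assms(2) by (metis norm_ge_zero power_eq_1_iff real_norm_def abs_of_nonneg totient_0_iff neq0_conv)
qed

lemma norm_dchars_le:
  assumes "\<chi> \<in> dchars M" "M > 0"
  shows "norm (\<chi> n) \<le> 1"
  using norm_dchars[OF assms, of n] dchars_eq_0_iff[OF assms(1), of n]
  by (cases "coprime n M") auto

lemma principal_in_dchars: "M > 0 \<Longrightarrow> principal_char M \<in> dchars M"
  by (auto simp: dchars_def principal_char_def)

lemma times_in_dchars:
  "\<chi> \<in> dchars M \<Longrightarrow> \<psi> \<in> dchars M \<Longrightarrow> (\<lambda>n. \<chi> n * \<psi> n) \<in> dchars M"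
  by (auto simp: dchars_def)

lemma cnj_in_dchars: "\<chi> \<in> dchars M \<Longrightarrow> (\<lambda>n. cnj (\<chi> n)) \<in> dchars M"
  by (auto simp: dchars_def)

lemma dchars_times_cnj:
  assumes "\<chi> \<in> dchars M" "M > 0" "coprime n M"
  shows "\<chi> n * cnj (\<chi> n) = 1"
  using norm_dchars[OF assms] complex_norm_square[of "\<chi> n"] by simp

text \<open>A character is determined by its values on residues, and each of these is 0 or a root of
  unity of order dividing \<open>totient M\<close>.\<close>

lemma finite_dchars:
  assumes "M > 0"
  shows "finite (dchars M)"
proof -
  let ?R = "insert 0 {z::complex. z ^ totient M = 1}"
  let ?F = "PiE {..<M} (\<lambda>_. ?R)"
  have fin: "finite ?F"
    using assms by (intro finite_PiE) (auto intro!: finite_roots_unity simp: Suc_le_eq)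
  have inj: "inj_on (\<lambda>\<chi>. restrict \<chi> {..<M}) (dchars M)"
  proof (rule inj_onI)
    fix \<chi> \<psi> assume h: "\<chi> \<in> dchars M" "\<psi> \<in> dchars M" "restrict \<chi> {..<M} = restrict \<psi> {..<M}"
    show "\<chi> = \<psi>"
    proof
      fix n
      have "\<chi> (n mod M) = \<psi> (n mod M)"
        using h(3) assms by (metis lessThan_iff mod_less_divisor restrict_apply')
      then show "\<chi> n = \<psi> n" using h dchars_mod by metis
    qed
  qed
  have sub: "(\<lambda>\<chi>. restrict \<chi> {..<M}) ` dchars M \<subseteq> ?F"
  proof (intro image_subsetI restrict_PiE_iff[THEN iffD2] ballI)
    fix \<chi> i assume "\<chi> \<in> dchars M"
    then show "\<chi> i \<in> ?R"
      using dchars_root_unity[of \<chi> M i] dchars_eq_0_iff[of \<chi> M i] by auto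
  qed
  show ?thesis
    using finite_imageD[OF finite_subset[OF sub fin] inj] .
qed

text \<open>Multiplication by \<open>\<psi>\<close> permutes the characters, so the sum is unchanged
  when multiplied by \<open>\<psi> b \<noteq> 1\<close>.\<close>

lemma dchars_sum_eq_0:
  assumes \<psi>: "\<psi> \<in> dchars M" and "\<psi> b \<noteq> 1" "M > 0" "coprime b M"
  shows "(\<Sum>\<chi>\<in>dchars M. \<chi> b) = 0"
proof -
  have "bij_betw (\<lambda>\<chi> n. \<psi> n * \<chi> n) (dchars M) (dchars M)"
  proof (rule bij_betwI[where g = "\<lambda>\<chi> n. cnj (\<psi> n) * \<chi> n"])
    \<comment> \<open>The conjugate inverts \<open>\<psi>\<close> on units; at all other arguments
      both sides vanish.\<close>
    have *: "\<psi> n * (cnj (\<psi> n) * \<chi> n) = \<chi> n" if "\<chi> \<in> dchars M" for \<chi> n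
      using that dchars_times_cnj[OF \<psi> assms(3), of n] dchars_eq_0_iff[OF that, of n]
      by (cases "coprime n M") (auto simp: mult.assoc[symmetric])
    then show "(\<lambda>n. cnj (\<psi> n) * (\<psi> n * \<chi> n)) = \<chi>" if "\<chi> \<in> dchars M" for \<chi>
      using that by (auto simp: mult.left_commute)
    show "(\<lambda>n. \<psi> n * (cnj (\<psi> n) * \<chi> n)) = \<chi>" if "\<chi> \<in> dchars M" for \<chi>
      using * that by auto
  qed (auto intro!: times_in_dchars cnj_in_dchars \<psi>)
  from sum.reindex_bij_betw[OF this, of "\<lambda>\<chi>. \<chi> b"]
  have "\<psi> b * (\<Sum>\<chi>\<in>dchars M. \<chi> b) = (\<Sum>\<chi>\<in>dchars M. \<chi> b)"
    by (simp add: sum_distrib_left)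
  then show ?thesis using assms(2) by simp
qed

lemma dchars_nonprincipal_witness:
  assumes "\<chi> \<in> dchars M" "\<chi> \<noteq> principal_char M"
  obtains a where "coprime a M" "\<chi> a \<noteq> 1"
proof -
  have "\<exists>a. coprime a M \<and> \<chi> a \<noteq> 1"
  proof (rule ccontr)
    assume "\<not> ?thesis"
    then have "\<chi> n = principal_char M n" for n
      using dchars_eq_0_iff[OF assms(1), of n] by (auto simp: principal_char_def)
    then show False using assms(2) by blast
  qed
  then show ?thesis using that by blast
qed

text \<open>Multiplication by a unit \<open>a\<close> with \<open>\<chi> a \<noteq> 1\<close>
  permutes the residues.\<close>

lemma dchars_sum_residues:
  assumes \<chi>: "\<chi> \<in> dchars M" "\<chi> \<noteq> principal_char M" and "M > 0"
  shows "(\<Sum>n<M. \<chi> n) = 0"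
proof -
  obtain a where a: "coprime a M" "\<chi> a \<noteq> 1"
    using dchars_nonprincipal_witness[OF \<chi>] .
  have inj: "inj_on (\<lambda>n. a * n mod M) {..<M}"
  proof (rule inj_onI)
    fix x y assume h: "x \<in> {..<M}" "y \<in> {..<M}" "a * x mod M = a * y mod M"
    then have "[a * x = a * y] (mod M)" by (simp add: cong_def)
    then have "[x = y] (mod M)" using cong_mult_lcancel_nat a(1) by blast
    then show "x = y" using h by (simp add: cong_def)
  qed
  have "bij_betw (\<lambda>n. a * n mod M) {..<M} {..<M}"
    unfolding bij_betw_def using inj assms(3) by (intro conjI endo_inj_surj) auto
  from sum.reindex_bij_betw[OF this, of \<chi>]
  have "\<chi> a * (\<Sum>n<M. \<chi> n) = (\<Sum>n<M. \<chi> n)"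
    using \<chi>(1) by (simp add: sum_distrib_left dchars_mod dchars_mult)
  then show ?thesis using a(2) by simp
qed

text \<open>Full periods cancel, which leaves fewer than \<open>M\<close> terms of norm at most
  1.\<close>

lemma dchars_partial_sum:
  assumes \<chi>: "\<chi> \<in> dchars M" "\<chi> \<noteq> principal_char M" and "M > 0"
  shows "norm (\<Sum>n<k. \<chi> n) \<le> real M"
proof (induction k rule: less_induct)
  case (less k)
  show ?case
  proof (cases "k < M")
    case True
    have "norm (\<Sum>n<k. \<chi> n) \<le> (\<Sum>n<k. 1)"
      by (rule sum_norm_le) (use norm_dchars_le[OF \<chi>(1) assms(3)] in auto)
    with True show ?thesis by simp
  next
    case False
    then obtain j where j: "k = M + j" using le_Suc_ex not_less by blast
    have "(\<Sum>n<k. \<chi> n) = (\<Sum>n<M. \<chi> n) + (\<Sum>n=0+M..<j+M. \<chi> n)"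
      using sum.atLeastLessThan_concat[of 0 M "M + j" \<chi>]
      by (simp add: j atLeast0LessThan add.commute)
    also have "(\<Sum>n=0+M..<j+M. \<chi> n) = (\<Sum>n<j. \<chi> (n + M))"
      unfolding sum.shift_bounds_nat_ivl by (simp add: atLeast0LessThan)
    also have "\<dots> = (\<Sum>n<j. \<chi> n)"
      by (intro sum.cong refl dchars_cong[OF \<chi>(1)]) (simp add: cong_def)
    finally show ?thesis
      using less[of j] assms(3) j dchars_sum_residues[OF assms] by simp
  qed
qed

text \<open>The units modulo a prime \<open>l\<close> form a cyclic group, so a discrete logarithm
  composed with a root of unity of exact order \<open>totient l\<close> is a faithful character
  modulo \<open>l\<close>. It is restricted to arguments coprime to \<open>M\<close>.\<close>

lemma dchars_separate_prime:
  fixes M l a :: nat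
  assumes "M > 0" "prime l" "l dvd M" "coprime a M" "\<not> [a = 1] (mod l)"
  obtains \<chi> where "\<chi> \<in> dchars M" "\<chi> a \<noteq> 1"
proof -
  obtain g where g: "residue_primroot l g"
    using prime_primitive_root_exists[of l] assms(2) prime_gt_1_nat by blast
  then have cg: "coprime l g" and og: "ord l g = totient l"
    by (auto simp: residue_primroot_def)
  have ex: "\<exists>i. [g ^ i = n] (mod l)" if "coprime n l" for n
  proof -
    have "\<not> l dvd n" using that assms(2) by (metis coprime_absorb_right not_prime_unit)
    then have "n mod l \<in> totatives l"
      using that assms(2) by (auto simp: totatives_def prime_gt_0_nat mod_greater_zero_iff_not_dvd)
    also have "totatives l = (\<lambda>i. g ^ i mod l) ` {..<totient l}"
      using residue_primroot_is_generator[OF _ g] prime_gt_1_nat[OF assms(2)]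
      by (simp add: bij_betw_def)
    finally obtain i where "n mod l = g ^ i mod l" by blast
    then show ?thesis by (auto simp: cong_def)
  qed
  \<comment> \<open>A discrete logarithm to base \<open>g\<close>. It is determined only modulo
    \<open>totient l\<close>, which is all that powers of \<open>\<omega>\<close> depend on.\<close>
  define ind where "ind n = (SOME i. [g ^ i = n] (mod l))" for n
  have ind: "[g ^ ind n = n] (mod l)" if "coprime n l" for n
    unfolding ind_def using someI_ex[OF ex[OF that]] .
  define \<omega> where "\<omega> = cis (2 * pi / real (totient l))"
  have \<omega>: "\<omega> ^ i = \<omega> ^ j" if "[i = j] (mod totient l)" for i j
  proof -
    have t: "\<omega> ^ totient l = 1"
      unfolding \<omega>_def by (simp add: DeMoivre assms(2) prime_gt_0_nat)
    have "\<omega> ^ i = \<omega> ^ (i mod totient l)" for i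
      by (metis t div_mult_mod_eq mult.commute mult_1 power_add power_mult power_one)
    then show ?thesis using that by (metis cong_def)
  qed
  have cop: "coprime n l" if "coprime n M" for n
    using that assms(3) by (metis coprime_divisors dvd_refl)
  define \<chi> where "\<chi> n = (if coprime n M then \<omega> ^ ind n else 0)" for n
  have "\<chi> (m * n) = \<chi> m * \<chi> n" for m n
  proof (cases "coprime m M \<and> coprime n M")
    case True
    then have "[g ^ ind (m * n) = m * n] (mod l)" "[g ^ (ind m + ind n) = m * n] (mod l)"
      unfolding power_add using cong_mult[OF ind ind] by (auto intro!: ind cop)
    then have "[g ^ ind (m * n) = g ^ (ind m + ind n)] (mod l)"
      using cong_trans cong_sym by blast
    then have "[ind (m * n) = ind m + ind n] (mod totient l)"
      using order_divides_expdiff cg og by metis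
    from \<omega>[OF this] True show ?thesis
      by (simp add: \<chi>_def power_add)
  qed (auto simp: \<chi>_def)
  moreover have "\<chi> (n mod M) = \<chi> n" for n
  proof (cases "coprime n M")
    case True
    then have "coprime (n mod M) M" using assms(1) by simp
    moreover have "[n mod M = n] (mod l)"
      using assms(3) by (meson cong_dvd_modulus_nat cong_mod_left cong_refl)
    ultimately have "[g ^ ind (n mod M) = g ^ ind n] (mod l)"
      using ind cop True cong_trans cong_sym by meson
    then have "[ind (n mod M) = ind n] (mod totient l)"
      using order_divides_expdiff cg og by metis
    from \<omega>[OF this] True show ?thesis using assms(1)
      by (simp add: \<chi>_def)
  qed (use assms(1) in \<open>auto simp: \<chi>_def\<close>)
  moreover have "\<omega> \<noteq> 0" by (simp add: \<omega>_def)
  ultimately have "\<chi> \<in> dchars M" by (auto simp: dchars_def) (auto simp: \<chi>_def split: if_splits)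
  moreover have "\<chi> a \<noteq> 1"
  proof
    assume "\<chi> a = 1"
    then have "cis (2 * pi * real (ind a) / real (totient l)) = 1"
      using assms(4) by (simp add: \<chi>_def \<omega>_def DeMoivre mult_ac)
    then have "cos (2 * pi * real (ind a) / real (totient l)) = 1"
      by (metis cis.sel(1) one_complex.sel(1))
    then obtain k :: int where "2 * pi * real (ind a) / real (totient l) = of_int k * 2 * pi"
      using cos_one_2pi_int by metis
    then have "real (ind a) = real_of_int k * real (totient l)"
      using assms(2) by (simp add: field_simps prime_gt_0_nat)
    then have "int (ind a) = k * int (totient l)"
      by (metis of_int_eq_iff of_int_mult of_int_of_nat_eq)
    then have "totient l dvd ind a"
      by (metis dvd_triv_right int_dvd_int_iff)
    then have "[g ^ ind a = 1] (mod l)"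
      using ord_divides og by metis
    then have "[a = 1] (mod l)"
      using ind[OF cop[OF assms(4)]] cong_trans cong_sym by blast
    with assms(5) show False by simp
  qed
  ultimately show ?thesis by (rule that)
qed

text \<open>For squarefree \<open>M\<close>, a congruence modulo \<open>M\<close> amounts to
  congruences modulo its prime factors. So \<open>b\<close> differs from 1 modulo one of them, and a
  character faithful modulo that prime separates the two.\<close>

lemma dchars_orthogonality:
  assumes "squarefree M" "coprime b M"
  shows "(\<Sum>\<chi>\<in>dchars M. \<chi> b) = (if [b = 1] (mod M) then of_nat (card (dchars M)) else 0)"
proof (cases "[b = 1] (mod M)")
  case True
  then have "\<chi> b = 1" if "\<chi> \<in> dchars M" for \<chi>
    using dchars_cong[OF that True] dchars_1[OF that] by simp
  then have "(\<Sum>\<chi>\<in>dchars M. \<chi> b) = (\<Sum>\<chi>\<in>dchars M. 1)" by (intro sum.cong) auto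
  with True show ?thesis by simp
next
  case False
  have M: "M > 0" using assms(1) by (cases "M = 0") auto
  have "\<exists>l. prime l \<and> l dvd M \<and> \<not> [b = 1] (mod l)"
  proof (rule ccontr)
    assume "\<not> ?thesis"
    then have *: "\<And>l. prime l \<Longrightarrow> l dvd M \<Longrightarrow> [b = 1] (mod l)" by blast
    have "[b = 1] (mod (\<Prod>l\<in>prime_factors M. l))"
      by (rule coprime_cong_prod_nat) (auto intro!: primes_coprime *[simplified] simp: in_prime_factors_iff)
    also have "(\<Prod>l\<in>prime_factors M. l) = (\<Prod>l\<in>prime_factors M. l ^ multiplicity l M)"
      using assms(1) M by (intro prod.cong refl) (simp add: squarefree_factorial_semiring')
    also have "\<dots> = M" using M by (simp add: prime_factorization_nat[symmetric])
    finally show False using False by simp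
  qed
  then obtain l where l: "prime l" "l dvd M" "\<not> [b = 1] (mod l)" by blast
  obtain \<psi> where "\<psi> \<in> dchars M" "\<psi> b \<noteq> 1"
    using dchars_separate_prime[OF M l(1,2) assms(2) l(3)] .
  with dchars_sum_eq_0[OF _ _ M assms(2)] False show ?thesis by simp
qed

section \<open>The functions of Moebius and von Mangoldt\<close>

lemma real_of_nat_div_le: "real (x div d) \<le> real x / real d"
  by (metis floor_divide_of_nat_eq of_int_floor_le of_int_of_nat_eq)

lemma real_of_nat_div_gt: "real x / real d < real (x div d) + 1"
  by (metis floor_divide_of_nat_eq of_int_of_nat_eq real_of_int_floor_add_one_gt)

text \<open>Pairs \<open>d dvd n\<close> with \<open>n \<le> x\<close> correspond to products
  \<open>n = d * m\<close> with \<open>m \<le> x div d\<close>. This turns the summatory function of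
  a Dirichlet convolution into a sum weighted with partial sums.\<close>

lemma sum_divisors_swap:
  fixes g :: "nat \<Rightarrow> nat \<Rightarrow> 'a::comm_monoid_add"
  shows "(\<Sum>n=1..x. \<Sum>d | d dvd n. g d (n div d)) = (\<Sum>d=1..x. \<Sum>m=1..x div d. g d m)"
proof -
  have "(\<Sum>n=1..x. \<Sum>d | d dvd n. g d (n div d)) =
      (\<Sum>(n, d)\<in>Sigma {1..x} (\<lambda>n. {d. d dvd n}). g d (n div d))"
    by (rule sum.Sigma) auto
  also have "\<dots> = (\<Sum>(d, m)\<in>Sigma {1..x} (\<lambda>d. {1..x div d}). g d m)"
  proof (rule sum.reindex_bij_witness[where i = "\<lambda>(d, m). (d * m, d)" and j = "\<lambda>(n, d). (d, n div d)"])
    fix a assume a: "a \<in> Sigma {1..x} (\<lambda>n. {d. d dvd n})"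
    then obtain n d where nd: "a = (n, d)" "1 \<le> n" "n \<le> x" "d dvd n" by auto
    then have "d \<le> n" "d > 0" by (auto dest: dvd_imp_le intro!: Nat.gr0I)
    moreover have "n div d > 0" using nd \<open>d \<le> n\<close> \<open>d > 0\<close> by (simp add: div_greater_zero_iff)
    ultimately show "(case a of (n, d) \<Rightarrow> (d, n div d)) \<in> Sigma {1..x} (\<lambda>d. {1..x div d})"
      using nd by (auto intro!: div_le_mono)
  next
    fix b assume b: "b \<in> Sigma {1..x} (\<lambda>d. {1..x div d})"
    then obtain d m where dm: "b = (d, m)" "1 \<le> d" "1 \<le> m" "m \<le> x div d" by auto
    then have "d * m \<le> x" by (metis div_times_less_eq_dividend le_trans mult.commute mult_le_mono1)
    then show "(case b of (d, m) \<Rightarrow> (d * m, d)) \<in> Sigma {1..x} (\<lambda>n. {d. d dvd n})"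
      using dm by auto
  qed auto
  also have "\<dots> = (\<Sum>d=1..x. \<Sum>m=1..x div d. g d m)"
    by (rule sum.Sigma[symmetric]) auto
  finally show ?thesis .
qed

text \<open>Both sides sum \<open>f d * g e\<close> over all pairs with
  \<open>d * e dvd n\<close>.\<close>

lemma sum_divisors_nested_swap:
  fixes f g :: "nat \<Rightarrow> 'a::comm_semiring_0"
  assumes "n > 0"
  shows "(\<Sum>d | d dvd n. f d * (\<Sum>e | e dvd n div d. g e)) =
         (\<Sum>e | e dvd n. g e * (\<Sum>d | d dvd n div e. f d))"
proof -
  have iff: "e dvd n div d \<longleftrightarrow> e dvd n \<and> d * e dvd n" if "d dvd n" for d e
    using that assms by (auto elim!: dvdE simp: mult.assoc mult.left_commute)
  have fin: "finite {d. d dvd n}" using assms by simp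
  have eq: "(\<Sum>d | d dvd n. f d * (\<Sum>e | e dvd n div d. g e)) =
      (\<Sum>d | d dvd n. \<Sum>e\<in>{e \<in> {e. e dvd n}. d * e dvd n}. f d * g e)" for f g :: "nat \<Rightarrow> 'a"
    by (intro sum.cong refl) (simp add: sum_distrib_left iff cong: conj_cong)
  show ?thesis
    using sum.swap_restrict[OF fin fin, of "\<lambda>d e. f d * g e" "\<lambda>d e. d * e dvd n"]
    by (simp only: eq[of f g] eq[of g f]) (simp add: mult.commute)
qed

section \<open>The Moebius function and inversion\<close>

definition moebius :: "nat \<Rightarrow> real" where
  "moebius n = (if squarefree n then (-1) ^ card (prime_factors n) else 0)"

lemma abs_moebius_le: "\<bar>moebius n\<bar> \<le> 1"
  by (simp add: moebius_def power_abs)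

lemma moebius_1: "moebius (Suc 0) = 1"
  by (simp add: moebius_def)

lemma moebius_prime_mult:
  assumes "prime p" "\<not> p dvd d" "d > 0"
  shows "moebius (p * d) = - moebius d"
proof -
  have "coprime p d" using assms prime_imp_coprime by blast
  then have "squarefree (p * d) \<longleftrightarrow> squarefree d"
    using squarefree_mult_coprime squarefree_multD squarefree_prime assms(1) by blast
  moreover have "prime_factors (p * d) = insert p (prime_factors d)"
    using assms by (simp add: prime_factors_product prime_prime_factors)
  moreover have "p \<notin> prime_factors d" using assms(2) by auto
  ultimately show ?thesis by (simp add: moebius_def)
qed

text \<open>Only squarefree divisors count. For a fixed prime \<open>p\<close> dividing
  \<open>n\<close>, the terms at \<open>d\<close> and \<open>p * d\<close> cancel.\<close>

lemma sum_moebius: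
  assumes "n > 0"
  shows "(\<Sum>d | d dvd n. moebius d) = (if n = 1 then 1 else 0)"
proof (cases "n = 1")
  case False
  then obtain p where p: "prime p" "p dvd n" using prime_factor_nat by blast
  define A where "A = {d. d dvd n \<and> squarefree d \<and> \<not> p dvd d}"
  have fin: "finite A" using assms by (simp add: A_def)
  have "{d. d dvd n \<and> squarefree d} = A \<union> (*) p ` A"
  proof (intro equalityI subsetI)
    fix d assume d: "d \<in> {d. d dvd n \<and> squarefree d}"
    show "d \<in> A \<union> (*) p ` A"
    proof (cases "p dvd d")
      case True
      then obtain e where e: "d = p * e" by blast
      have "\<not> p dvd e"
      proof
        assume "p dvd e"
        then have "p\<^sup>2 dvd d" by (simp add: e power2_eq_square mult_dvd_mono)
        then have "p dvd 1" using d squarefreeD by blast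
        then show False using p(1) by simp
      qed
      moreover have "e dvd n" "squarefree e"
        using d e squarefree_multD(2)[of p e] by (auto dest: dvd_mult_right)
      ultimately have "e \<in> A" by (simp add: A_def)
      then show ?thesis using e by blast
    qed (use d in \<open>simp add: A_def\<close>)
  next
    fix d assume "d \<in> A \<union> (*) p ` A"
    then show "d \<in> {d. d dvd n \<and> squarefree d}"
    proof
      assume "d \<in> (*) p ` A"
      then obtain e where e: "e \<in> A" "d = p * e" by blast
      then have c: "coprime p e" using p(1) by (auto simp: A_def intro: prime_imp_coprime)
      then have "d dvd n" using e p(2) by (auto simp: A_def intro: divides_mult)
      moreover have "squarefree d"
        using e c p(1) by (auto intro!: squarefree_mult_coprime intro: squarefree_prime simp: A_def)
      ultimately show ?thesis by simp
    qed (simp add: A_def)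
  qed
  moreover have "A \<inter> (*) p ` A = {}" by (auto simp: A_def)
  ultimately have "(\<Sum>d | d dvd n \<and> squarefree d. moebius d) = sum moebius A + sum moebius ((*) p ` A)"
    using fin by (simp add: sum.union_disjoint)
  also have "sum moebius ((*) p ` A) = (\<Sum>d\<in>A. - moebius d)"
  proof (subst sum.reindex)
    show "inj_on ((*) p) A" using p(1) by (auto simp: inj_on_def)
    show "sum (moebius \<circ> (*) p) A = (\<Sum>d\<in>A. - moebius d)"
      using p(1) assms by (intro sum.cong refl) (auto simp: A_def intro!: moebius_prime_mult Nat.gr0I)
  qed
  finally have "(\<Sum>d | d dvd n \<and> squarefree d. moebius d) = 0" by (simp add: sum_negf)
  moreover have "(\<Sum>d | d dvd n. moebius d) = (\<Sum>d | d dvd n \<and> squarefree d. moebius d)"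
    using assms by (intro sum.mono_neutral_right) (auto simp: moebius_def)
  ultimately show ?thesis using False by simp
qed (simp add: moebius_1)

text \<open>Moebius inversion of the identity that \<open>ln n\<close> is the sum of
  \<open>mangoldt\<close> over the divisors of \<open>n\<close>.\<close>

lemma sum_moebius_ln:
  assumes "n > 0"
  shows "(\<Sum>d | d dvd n. moebius d * ln (real (n div d))) = mangoldt n"
proof -
  have "(\<Sum>d | d dvd n. moebius d * ln (real (n div d))) =
        (\<Sum>d | d dvd n. moebius d * (\<Sum>e | e dvd n div d. mangoldt e))"
    using assms by (intro sum.cong refl) (auto simp: mangoldt_sum dvd_div_eq_0_iff)
  also have "\<dots> = (\<Sum>e | e dvd n. mangoldt e * (\<Sum>d | d dvd n div e. moebius d))"
    by (rule sum_divisors_nested_swap[OF assms])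
  also have "\<dots> = (\<Sum>e | e dvd n. if e = n then mangoldt e else 0)"
  proof (intro sum.cong refl)
    fix e assume "e \<in> {e. e dvd n}"
    then have "n div e > 0" "n div e = 1 \<longleftrightarrow> e = n"
      using assms by (auto elim!: dvdE)
    then show "mangoldt e * (\<Sum>d | d dvd n div e. moebius d) = (if e = n then mangoldt e else 0)"
      by (simp add: sum_moebius)
  qed
  also have "\<dots> = mangoldt n" using assms by simp
  finally show ?thesis .
qed

section \<open>Estimates of Chebyshev and Mertens\<close>

lemma ln_fact_sum: "ln (fact x :: real) = (\<Sum>n=1..x. ln (real n))"
  by (induction x) (simp_all add: ln_mult)

lemma ln_fact_mangoldt: "ln (fact x :: real) = (\<Sum>d=1..x. mangoldt d * real (x div d))"
proof -
  have "ln (fact x :: real) = (\<Sum>n=1..x. \<Sum>d | d dvd n. mangoldt d)"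
    unfolding ln_fact_sum by (intro sum.cong refl) (simp add: mangoldt_sum)
  also have "\<dots> = (\<Sum>d=1..x. \<Sum>m=1..x div d. mangoldt d)"
    using sum_divisors_swap[of "\<lambda>d m. mangoldt d" x] .
  finally show ?thesis by (simp add: mult.commute)
qed

text \<open>The easy half of Stirling's formula; the induction step is
  \<open>ln (1 + 1 / n) \<le> 1 / n\<close>.\<close>

lemma ln_fact_ge:
  assumes "x > 0"
  shows "ln (fact x :: real) \<ge> x * ln x - x"
  using assms
proof (induction x rule: nat_induct_non_zero)
  case (Suc n)
  have "ln (1 + 1 / real n) \<le> 1 / real n" by (rule ln_add_one_self_le_self) simp
  moreover have "1 + 1 / real n = real (Suc n) / real n" using Suc by (simp add: field_simps)
  ultimately have "ln (real (Suc n)) \<le> ln (real n) + 1 / real n"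
    using Suc by (simp add: ln_div)
  then have "real n * ln (real (Suc n)) \<le> real n * (ln (real n) + 1 / real n)"
    by (intro mult_left_mono) auto
  also have "\<dots> = real n * ln (real n) + 1" using Suc by (simp add: field_simps)
  finally have *: "real n * ln (real (Suc n)) \<le> real n * ln (real n) + 1" .
  have "ln (fact (Suc n) :: real) = ln (real (Suc n)) + ln (fact n)"
    by (simp add: ln_mult)
  with Suc.IH * show ?case by (simp add: algebra_simps)
qed simp

lemma ln_fact_le: "ln (fact x :: real) \<le> x * ln x"
proof -
  have "(\<Sum>n=1..x. ln (real n)) \<le> (\<Sum>n=1..x. ln (real x))"
    by (intro sum_mono) auto
  then show ?thesis by (simp add: ln_fact_sum)
qed

text \<open>Chebyshev's argument: the logarithm of the central binomial coefficient is a sum of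
  \<open>mangoldt d\<close> with nonnegative coefficients that equal 1 for
  \<open>n < d \<le> 2 * n\<close>, while the coefficient itself is at most
  \<open>2 ^ (2 * n)\<close>.\<close>

lemma sum_mangoldt_double:
  "(\<Sum>d=1..2*n. mangoldt d) \<le> (\<Sum>d=1..n. mangoldt d) + 2 * real n"
proof -
  have "(\<Sum>d=1..n. mangoldt d * real (n div d)) = (\<Sum>d=1..2*n. mangoldt d * real (n div d))"
    by (rule sum.mono_neutral_left) auto
  then have eq: "ln (fact (2*n) :: real) - 2 * ln (fact n) =
      (\<Sum>d=1..2*n. mangoldt d * (real (2*n div d) - 2 * real (n div d)))"
    unfolding ln_fact_mangoldt by (simp add: sum_subtractf sum_distrib_left algebra_simps)
  have "(\<Sum>d\<in>{n+1..2*n}. mangoldt d) = (\<Sum>d\<in>{n+1..2*n}. mangoldt d * (real (2*n div d) - 2 * real (n div d)))"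
  proof (intro sum.cong refl)
    fix d assume d: "d \<in> {n+1..2*n}"
    then have "2 * n div d = 1" by (intro div_nat_eqI) auto
    with d show "mangoldt d = mangoldt d * (real (2*n div d) - 2 * real (n div d))" by simp
  qed
  also have "\<dots> \<le> (\<Sum>d=1..2*n. mangoldt d * (real (2*n div d) - 2 * real (n div d)))"
  proof (intro sum_mono2)
    fix d assume "d \<in> {1..2*n} - {n+1..2*n}"
    have "2 * (n div d) \<le> 2 * n div d" by (metis div_mult1_eq le_add1 mult.commute)
    then have "2 * real (n div d) \<le> real (2 * n div d)" by linarith
    then show "0 \<le> mangoldt d * (real (2*n div d) - 2 * real (n div d))"
      by (intro mult_nonneg_nonneg mangoldt_nonneg) simp
  qed auto
  also have "\<dots> = ln (real (2*n choose n))"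
  proof -
    have "(fact (2*n) :: real) = fact n * fact n * real (2*n choose n)"
      using binomial_fact_lemma[of n "2*n"] by (metis of_nat_fact of_nat_mult mult_2 add_diff_cancel_left' le_add1)
    then have "ln (fact (2*n) :: real) = ln (fact n) + ln (fact n) + ln (real (2*n choose n))"
      by (simp add: ln_mult)
    then show ?thesis using eq by simp
  qed
  also have "\<dots> \<le> ln (2 ^ (2*n))"
    using binomial_le_pow2[of "2*n" n] by (subst ln_le_cancel_iff) (auto simp flip: of_nat_le_iff)
  also have "\<dots> = 2 * real n * ln 2" by (simp add: ln_realpow)
  also have "\<dots> \<le> 2 * real n" using ln_le_minus_one[of "2::real"] by (simp add: mult_left_le)
  finally have "(\<Sum>d\<in>{n+1..2*n}. mangoldt d) \<le> 2 * real n" .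
  moreover have "(\<Sum>d=1..2*n. mangoldt d :: real) = (\<Sum>d=1..n. mangoldt d) + (\<Sum>d\<in>{n+1..2*n}. mangoldt d)"
    using sum.ub_add_nat[of 1 n "mangoldt :: nat \<Rightarrow> real" n] by (simp add: mult_2)
  ultimately show ?thesis by simp
qed

lemma chebyshev_upper: "(\<Sum>d=1..n. mangoldt d) \<le> 6 * real n"
proof (induction n rule: less_induct)
  case (less n)
  show ?case
  proof (cases "n \<le> 1")
    case True
    then consider "n = 0" | "n = 1" by linarith
    then show ?thesis by cases auto
  next
    case False
    \<comment> \<open>Rounding up gives \<open>8 * m \<le> 4 * (n + 1) \<le> 6 * n\<close> for
      \<open>n \<ge> 2\<close>, whence the constant 6.\<close>
    define m where "m = (n + 1) div 2"
    have m: "m < n" "n \<le> 2 * m" "2 * m \<le> n + 1" using False by (auto simp: m_def)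
    have "(\<Sum>d=1..n. mangoldt d :: real) \<le> (\<Sum>d=1..2*m. mangoldt d)"
      using m by (intro sum_mono2) (auto intro: mangoldt_nonneg)
    also have "\<dots> \<le> (\<Sum>d=1..m. mangoldt d) + 2 * real m" by (rule sum_mangoldt_double)
    also have "\<dots> \<le> 8 * real m" using less[OF m(1)] by simp
    also have "\<dots> \<le> 6 * real n" using m(3) False by linarith
    finally show ?thesis .
  qed
qed

text \<open>In the expansion of \<open>ln (fact x)\<close> over \<open>mangoldt\<close>, rounded
  quotients are replaced by exact ones and the result is divided by \<open>x\<close>.\<close>

lemma mertens_lower:
  assumes "x > 0"
  shows "(\<Sum>d=1..x. mangoldt d / d) \<ge> ln (real x) - 1"
proof -
  have "x * ln x - x \<le> (\<Sum>d=1..x. mangoldt d * real (x div d))"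
    using ln_fact_ge[OF assms] by (simp add: ln_fact_mangoldt)
  also have "\<dots> \<le> (\<Sum>d=1..x. mangoldt d * (real x / real d))"
    by (intro sum_mono mult_left_mono mangoldt_nonneg real_of_nat_div_le)
  also have "\<dots> = x * (\<Sum>d=1..x. mangoldt d / d)"
    by (simp add: sum_distrib_left mult_ac)
  finally have "real x * (ln x - 1) \<le> x * (\<Sum>d=1..x. mangoldt d / d)"
    by (simp add: algebra_simps)
  then show ?thesis using assms by simp
qed

lemma mertens_upper:
  assumes "x > 0"
  shows "(\<Sum>d=1..x. mangoldt d / d) \<le> ln (real x) + 6"
proof -
  have "x * (\<Sum>d=1..x. mangoldt d / d) = (\<Sum>d=1..x. mangoldt d * (real x / real d))"
    by (simp add: sum_distrib_left mult_ac)
  \<comment> \<open>Rounding loses at most 1 per term, in total at most the Chebyshev sum.\<close>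
  also have "\<dots> \<le> (\<Sum>d=1..x. mangoldt d * (real (x div d) + 1))"
    by (intro sum_mono mult_left_mono mangoldt_nonneg less_imp_le real_of_nat_div_gt)
  also have "\<dots> = ln (fact x) + (\<Sum>d=1..x. mangoldt d)"
    by (simp add: ln_fact_mangoldt algebra_simps sum.distrib)
  also have "\<dots> \<le> x * (ln x + 6)"
    using ln_fact_le[of x] chebyshev_upper[of x] by (simp add: algebra_simps)
  finally show ?thesis using assms by simp
qed

text \<open>The bound is chosen such that its increments dominate \<open>ln m / m\<^sup>2\<close>.\<close>

lemma sum_ln_over_square_le:
  assumes "x > 0"
  shows "(\<Sum>m=2..x. ln (real m) / real m ^ 2) \<le> 2 - (ln (real x) + 2) / x"
  using assms
proof (induction x rule: nat_induct_non_zero)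
  case (Suc n)
  define N where "N = real n + 1"
  have n: "real n \<ge> 1" using Suc by simp
  have "ln (1 + 1 / real n) \<le> 1 / real n" by (rule ln_add_one_self_le_self) simp
  moreover have "1 + 1 / real n = N / real n" using n by (simp add: field_simps N_def)
  ultimately have "ln N \<le> ln (real n) + 1 / real n"
    using n by (simp add: ln_div N_def)
  then have 1: "(ln N - 1 / n + 2) / n \<le> (ln (real n) + 2) / n"
    by (intro divide_right_mono) auto
  have l: "ln N \<ge> 0" using n by (simp add: N_def)
  \<comment> \<open>With \<open>a\<close> for \<open>ln N\<close> and \<open>y\<close> for
    \<open>n\<close>, the increment of the bound exceeds the new term by a sum of two nonnegative
    fractions.\<close>
  have "(a - 1 / y + 2) / y - (a + 2) / (y + 1) - a / (y + 1)\<^sup>2 =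
      a / (y * (y + 1)\<^sup>2) + (y - 1) / (y\<^sup>2 * (y + 1))" if "y \<ge> 1" for a y :: real
    using that by (simp add: divide_simps power2_eq_square) (simp add: algebra_simps)
  from this[OF n, of "ln N"]
  have "(ln N - 1 / n + 2) / n - (ln N + 2) / N - ln N / N ^ 2 =
      ln N / (n * N\<^sup>2) + (real n - 1) / (n\<^sup>2 * N)"
    by (simp add: N_def)
  also have "\<dots> \<ge> 0" using n l by (simp add: N_def)
  finally have 2: "ln N / N ^ 2 \<le> (ln N - 1 / n + 2) / n - (ln N + 2) / N" by simp
  have "(\<Sum>m=2..Suc n. ln (real m) / real m ^ 2) = (\<Sum>m=2..n. ln (real m) / real m ^ 2) + ln N / N ^ 2"
    using Suc by (subst sum.nat_ivl_Suc') (auto simp: N_def add.commute)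
  then show ?case using Suc.IH 1 2 by (simp add: N_def add.commute)
qed simp

lemma sum_reciprocal_powers_le:
  assumes "m \<ge> (2::nat)"
  shows "(\<Sum>k=2..x. 1 / real m ^ k) \<le> 2 / real m ^ 2"
proof (cases "2 \<le> x")
  case True
  define t where "t = 1 / real m"
  have t: "0 < t" "t \<le> 1 / 2" using assms by (auto simp: t_def field_simps)
  have "(1 - t) * (\<Sum>k=2..x. t ^ k) = t ^ 2 - t ^ Suc x" by (rule sum_gp_multiplied[OF True])
  also have "\<dots> \<le> t ^ 2" using t by simp
  also have "\<dots> \<le> (1 - t) * (2 * t ^ 2)" using mult_right_mono[of 1 "(1 - t) * 2" "t ^ 2"] t by simp
  finally have "(\<Sum>k=2..x. t ^ k) \<le> 2 * t ^ 2"
    using t by (subst (asm) mult_le_cancel_left_pos) auto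
  then show ?thesis by (simp add: t_def power_divide)
qed simp

text \<open>Only proper prime powers contribute. The geometric series over exponents
  \<open>k \<ge> 2\<close> gives at most \<open>2 * ln p / p^2\<close> for each prime, and these
  bounds are summed over all integers from 2 on.\<close>

lemma sum_mangoldt_nonprime_le:
  "(\<Sum>n | n \<in> {1..x} \<and> \<not> prime n. mangoldt n / n) \<le> 4"
proof -
  define I where "I = {p. p \<in> {2..x} \<and> prime p} \<times> {2..x}"
  define f :: "nat \<times> nat \<Rightarrow> nat" where "f = (\<lambda>(p, k). p ^ k)"
  have fin: "finite I" by (simp add: I_def)
  have "(\<Sum>n | n \<in> {1..x} \<and> \<not> prime n. mangoldt n / n) =
      (\<Sum>n | n \<in> {1..x} \<and> \<not> prime n \<and> primepow n. mangoldt n / n :: real)"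
    by (rule sum.mono_neutral_right) (auto simp: mangoldt_def)
  also have "\<dots> \<le> (\<Sum>n\<in>f ` I. mangoldt n / n)"
  proof (rule sum_mono2)
    show "{n. n \<in> {1..x} \<and> \<not> prime n \<and> primepow n} \<subseteq> f ` I"
    proof
      fix n assume "n \<in> {n. n \<in> {1..x} \<and> \<not> prime n \<and> primepow n}"
      then obtain p k where pk: "prime p" "k > 0" "n = p ^ k" "n \<le> x" "\<not> prime n"
        by (auto simp: primepow_def)
      then have "k \<noteq> 1" by auto
      with pk have "k \<ge> 2" by simp
      \<comment> \<open>Base and exponent are both at most \<open>x\<close>, so the finite box
        \<open>I\<close> contains all relevant pairs.\<close>
      moreover have "k < p ^ k" using pk(1) using power_gt_expt prime_gt_1_nat by (auto simp: Suc_le_eq)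
      moreover have "p \<le> p ^ k" using pk self_le_power[of p k] prime_ge_1_nat by blast
      ultimately have "(p, k) \<in> I" using pk prime_ge_2_nat by (auto simp: I_def)
      then show "n \<in> f ` I" using pk by (force simp: f_def)
    qed
  qed (use fin in \<open>auto intro!: divide_nonneg_nonneg mangoldt_nonneg\<close>)
  also have "\<dots> \<le> (\<Sum>i\<in>I. mangoldt (f i) / f i)"
    using sum_image_le[OF fin, of "\<lambda>n. mangoldt n / n :: real" f] by (simp add: mangoldt_nonneg o_def)
  also have "\<dots> = (\<Sum>(p, k)\<in>I. ln (real p) * (1 / real p ^ k))"
    by (intro sum.cong refl) (auto simp: I_def f_def)
  also have "\<dots> = (\<Sum>p | p \<in> {2..x} \<and> prime p. ln (real p) * (\<Sum>k=2..x. 1 / real p ^ k))"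
    unfolding I_def by (simp add: sum.cartesian_product sum_distrib_left)
  also have "\<dots> \<le> (\<Sum>p\<in>{2..x}. ln (real p) * (\<Sum>k=2..x. 1 / real p ^ k))"
    by (intro sum_mono2) (auto intro!: mult_nonneg_nonneg sum_nonneg)
  also have "\<dots> \<le> (\<Sum>p\<in>{2..x}. ln (real p) * (2 / real p ^ 2))"
    by (intro sum_mono mult_left_mono sum_reciprocal_powers_le) auto
  also have "\<dots> = 2 * (\<Sum>m=2..x. ln (real m) / real m ^ 2)"
    by (simp add: sum_distrib_left mult_ac)
  also have "\<dots> \<le> 4"
  proof (cases "x = 0")
    case False
    then have "(ln (real x) + 2) / x \<ge> 0" by (intro divide_nonneg_nonneg add_nonneg_nonneg ln_ge_zero) auto
    then show ?thesis using sum_ln_over_square_le[of x] False by linarith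
  qed simp
  finally show ?thesis .
qed

section \<open>Values of L-functions at 1\<close>

lemma abel_summation_bound:
  fixes f :: "nat \<Rightarrow> complex" and a :: "nat \<Rightarrow> real"
  assumes F: "\<And>k. norm (\<Sum>n=m..<k. f n) \<le> B"
    and dec: "\<And>n. n \<ge> m \<Longrightarrow> a (Suc n) \<le> a n" and pos: "\<And>n. n \<ge> m \<Longrightarrow> 0 \<le> a n"
  shows "norm (\<Sum>n=m..<k. of_real (a n) * f n) \<le> B * a m"
proof (cases "m \<le> k")
  case True
  define F' where "F' k = (\<Sum>n=m..<k. f n)" for k
  \<comment> \<open>Without its boundary term, the sum grows per step by \<open>F'\<close> times a
    decrement of \<open>a\<close>, so the bound telescopes.\<close>
  have "norm ((\<Sum>n=m..<k. of_real (a n) * f n) - of_real (a k) * F' k) \<le> B * (a m - a k)"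
    using True
  proof (induction k rule: dec_induct)
    case base
    then show ?case by (simp add: F'_def)
  next
    case (step k)
    have "(\<Sum>n=m..<Suc k. of_real (a n) * f n) - of_real (a (Suc k)) * F' (Suc k) =
        ((\<Sum>n=m..<k. of_real (a n) * f n) - of_real (a k) * F' k) + of_real (a k - a (Suc k)) * F' (Suc k)"
      using step(1) by (simp add: F'_def algebra_simps)
    also have "norm \<dots> \<le> B * (a m - a k) + (a k - a (Suc k)) * B"
    proof (rule norm_triangle_mono[OF step.IH])
      show "norm (of_real (a k - a (Suc k)) * F' (Suc k)) \<le> (a k - a (Suc k)) * B"
        using F[of "Suc k"] dec[OF step(1)]
        unfolding norm_mult norm_of_real F'_def by (intro mult_mono) auto
    qed
    finally show ?case by (simp add: algebra_simps)
  qed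
  moreover have "norm (of_real (a k) * F' k) \<le> a k * B"
    using F[of k] pos[OF True] unfolding norm_mult norm_of_real F'_def by (intro mult_mono) auto
  ultimately have "norm (((\<Sum>n=m..<k. of_real (a n) * f n) - of_real (a k) * F' k) + of_real (a k) * F' k)
      \<le> B * (a m - a k) + a k * B"
    by (rule norm_triangle_mono)
  then show ?thesis by (simp add: algebra_simps)
next
  case False
  have "0 \<le> B" using F[of m] by simp
  then show ?thesis using False pos[of m] by simp
qed

text \<open>The term at \<open>n = 0\<close> vanishes because \<open>x / 0 = 0\<close>.\<close>

definition L_value :: "(nat \<Rightarrow> complex) \<Rightarrow> complex" where
  "L_value \<chi> = (\<Sum>n. \<chi> n / of_nat n)"

definition mangoldt_sum_upto :: "(nat \<Rightarrow> complex) \<Rightarrow> nat \<Rightarrow> complex" where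
  "mangoldt_sum_upto \<chi> x = (\<Sum>n=1..x. \<chi> n * of_real (mangoldt n / n))"

locale nonprincipal_char =
  fixes M :: nat and \<chi> :: "nat \<Rightarrow> complex"
  assumes M: "M > 0" and \<chi>: "\<chi> \<in> dchars M" and nonprincipal: "\<chi> \<noteq> principal_char M"
begin

lemma norm_sum_le: "norm (\<Sum>n=m..<k. \<chi> n) \<le> 2 * real M"
proof (cases "m \<le> k")
  case True
  have "(\<Sum>n=m..<k. \<chi> n) = (\<Sum>n<k. \<chi> n) - (\<Sum>n<m. \<chi> n)"
    using sum.atLeastLessThan_concat[of 0 m k \<chi>] True
    by (simp add: atLeast0LessThan algebra_simps)
  also have "norm \<dots> \<le> real M + real M"
    using dchars_partial_sum[OF \<chi> nonprincipal M] by (intro norm_triangle_le_diff add_mono)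
  finally show ?thesis by simp
qed simp

lemma norm_weighted_sum_le:
  assumes "\<And>n. n \<ge> m \<Longrightarrow> a (Suc n) \<le> a n" "\<And>n. n \<ge> m \<Longrightarrow> 0 \<le> a n"
  shows "norm (\<Sum>n=m..<k. of_real (a n) * \<chi> n) \<le> 2 * real M * a m"
  by (rule abel_summation_bound[where f = \<chi>]) (use norm_sum_le assms in auto)

lemma norm_reciprocal_sum_le:
  assumes "m > 0"
  shows "norm (\<Sum>n=m..<k. \<chi> n / of_nat n) \<le> 2 * real M / m"
  using norm_weighted_sum_le[of m "\<lambda>n. 1 / real n" k] assms
  by (simp add: frac_le divide_inverse mult.commute of_real_inverse)

text \<open>Convergence rests on cancellation, so the Cauchy criterion is applied with the tail
  bound from partial summation.\<close>

lemma summable_L_value: "summable (\<lambda>n. \<chi> n / of_nat n)"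
  unfolding summable_Cauchy
proof (intro allI impI)
  fix e :: real assume "e > 0"
  obtain N where "max 1 (2 * real M / e) < real N"
    using reals_Archimedean2 by blast
  then have N: "N > 0" "2 * real M / e < real N" by (auto intro!: Nat.gr0I)
  have "norm (\<Sum>n=m..<k. \<chi> n / of_nat n) < e" if "m \<ge> N" for m k
  proof -
    have "norm (\<Sum>n=m..<k. \<chi> n / of_nat n) \<le> 2 * real M / m"
      using that N by (intro norm_reciprocal_sum_le) simp
    also have "\<dots> \<le> 2 * real M / N" using that N by (intro divide_left_mono) auto
    also have "\<dots> < e" using N \<open>e > 0\<close> by (simp add: field_simps)
    finally show ?thesis .
  qed
  then show "\<exists>N. \<forall>m\<ge>N. \<forall>n. norm (\<Sum>n=m..<n. \<chi> n / of_nat n) < e" by blast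
qed

lemma norm_L_value_diff_le:
  "norm ((\<Sum>n=1..x. \<chi> n / of_nat n) - L_value \<chi>) \<le> 2 * real M / (real x + 1)"
proof -
  let ?f = "\<lambda>n. \<chi> n / of_nat n"
  have eq: "(\<Sum>n=1..x. ?f n) = (\<Sum>n<Suc x. ?f n)"
    by (rule sum.mono_neutral_left) (auto simp: Suc_le_eq)
  have "(\<lambda>k. norm ((\<Sum>n<k. ?f n) - (\<Sum>n<Suc x. ?f n))) \<longlonglongrightarrow> norm (L_value \<chi> - (\<Sum>n<Suc x. ?f n))"
    unfolding L_value_def by (intro tendsto_intros summable_LIMSEQ summable_L_value)
  moreover have "norm ((\<Sum>n<k. ?f n) - (\<Sum>n<Suc x. ?f n)) \<le> 2 * real M / (real x + 1)" if "k \<ge> Suc x" for k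
  proof -
    have "(\<Sum>n<k. ?f n) - (\<Sum>n<Suc x. ?f n) = (\<Sum>n=Suc x..<k. ?f n)"
      using sum.atLeastLessThan_concat[of 0 "Suc x" k ?f] that
      by (simp only: atLeast0LessThan) (simp add: algebra_simps)
    then show ?thesis using norm_reciprocal_sum_le[of "Suc x" k] by (simp add: add.commute)
  qed
  ultimately have "norm (L_value \<chi> - (\<Sum>n<Suc x. ?f n)) \<le> 2 * real M / (real x + 1)"
    by (intro LIMSEQ_le_const2) auto
  then show ?thesis unfolding eq by (simp only: norm_minus_commute)
qed

text \<open>The bound is made linear in \<open>d\<close> so that it cancels the weight
  \<open>1 / d\<close> in the sums over divisors.\<close>

lemma norm_L_value_diff_div_le:
  assumes "d > 0" "x > 0"
  shows "norm ((\<Sum>n=1..x div d. \<chi> n / of_nat n) - L_value \<chi>) \<le> 2 * real M * real d / real x"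
proof -
  have "2 * real M / (real (x div d) + 1) \<le> 2 * real M / (real x / real d)"
    using assms real_of_nat_div_gt[of x d] by (intro divide_left_mono mult_pos_pos) auto
  then show ?thesis using norm_L_value_diff_le[of "x div d"] by simp
qed

text \<open>\<open>ln n / n\<close> decreases only from \<open>n = 3\<close> on, as
  \<open>exp 1 \<le> 3\<close>. The term at 1 vanishes and the term at 2 has norm at most 1.\<close>

lemma norm_ln_sum_le:
  "norm (\<Sum>n=1..x. of_real (ln n / n) * \<chi> n) \<le> 1 + 2 * real M"
proof -
  let ?f = "\<lambda>n. of_real (ln (real n) / n) * \<chi> n"
  have ln3: "ln 3 \<ge> (1::real)" using exp_le by (subst ln_ge_iff) auto
  have "norm (\<Sum>n=3..<Suc x. ?f n) \<le> 2 * real M * (ln (real 3) / real 3)"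
  proof (rule norm_weighted_sum_le)
    fix n :: nat assume n: "n \<ge> 3"
    have "exp 1 \<le> real n" using exp_le n by (meson le_trans of_nat_mono numeral_le_real_of_nat_iff order_trans)
    then show "ln (real (Suc n)) / real (Suc n) \<le> ln (real n) / real n"
      by (intro ln_x_over_x_mono) auto
  qed simp
  also have "\<dots> \<le> 2 * real M * 1"
    using ln_le_minus_one[of "3::real"] by (intro mult_left_mono) auto
  finally have 1: "norm (\<Sum>n=3..<Suc x. ?f n) \<le> 2 * real M" by simp
  have l2: "norm (?f 2) \<le> 1"
    using norm_dchars_le[OF \<chi> M, of 2] ln_le_minus_one[of "2::real"]
    unfolding norm_mult by (intro mult_le_one) auto
  consider "x = 0" | "x = 1" | "x \<ge> 2" by linarith
  then show ?thesis
  proof cases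
    case 3
    then have "{1..x} = {1, 2} \<union> {3..<Suc x}" by auto
    then have "(\<Sum>n=1..x. ?f n) = (\<Sum>n\<in>{1, 2}. ?f n) + (\<Sum>n=3..<Suc x. ?f n)"
      by (simp only:) (rule sum.union_disjoint, auto)
    also have "\<dots> = ?f 2 + (\<Sum>n=3..<Suc x. ?f n)" by simp
    finally show ?thesis using norm_triangle_mono[OF l2 1] by simp
  qed auto
qed

text \<open>
  By \<open>ln = \<Lambda> * 1\<close>, the bounded sum of \<open>\<chi>(n) ln n / n\<close> equals that of \<open>\<chi>(d)\<Lambda>(d)/d\<close> weighted with partial
  sums of the L-series, which may be replaced by \<open>L(1,\<chi>)\<close>.
\<close>

lemma mangoldt_sum_bounded:
  assumes "L_value \<chi> \<noteq> 0"
  shows "\<exists>K. \<forall>x>0. norm (mangoldt_sum_upto \<chi> x) \<le> K"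
proof (intro exI allI impI)
  fix x :: nat assume x: "x > 0"
  define A where "A y = (\<Sum>n=1..y. \<chi> n / of_nat n)" for y
  let ?g = "\<lambda>d m. \<chi> d * of_real (mangoldt d / d) * (\<chi> m / of_nat m)"
  have "(\<Sum>n=1..x. of_real (ln n / n) * \<chi> n) = (\<Sum>n=1..x. \<Sum>d | d dvd n. ?g d (n div d))"
  proof (intro sum.cong refl)
    fix n assume n: "n \<in> {1..x}"
    have "(\<Sum>d | d dvd n. ?g d (n div d)) = (\<Sum>d | d dvd n. \<chi> n / of_nat n * of_real (mangoldt d))"
    proof (intro sum.cong refl)
      fix d assume "d \<in> {d. d dvd n}"
      then obtain m where m: "n = d * m" by auto
      with n have "d > 0" "m > 0" by (auto intro!: Nat.gr0I)
      with m show "?g d (n div d) = \<chi> n / of_nat n * of_real (mangoldt d)"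
        by (simp add: dchars_mult[OF \<chi>])
    qed
    also have "\<dots> = \<chi> n / of_nat n * of_real (\<Sum>d | d dvd n. mangoldt d)"
      by (simp only: sum_distrib_left of_real_sum)
    also have "(\<Sum>d | d dvd n. mangoldt d) = ln (real n)" using n by (simp add: mangoldt_sum)
    finally show "of_real (ln n / n) * \<chi> n = (\<Sum>d | d dvd n. ?g d (n div d))" by simp
  qed
  also have "\<dots> = (\<Sum>d=1..x. \<chi> d * of_real (mangoldt d / d) * A (x div d))"
    unfolding sum_divisors_swap[of ?g] A_def sum_distrib_left ..
  \<comment> \<open>Each partial sum is split into its limit \<open>L_value \<chi>\<close> and an
    error, and the limit is factored out.\<close>
  finally have eq: "L_value \<chi> * mangoldt_sum_upto \<chi> x =
      (\<Sum>n=1..x. of_real (ln n / n) * \<chi> n) -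
      (\<Sum>d=1..x. \<chi> d * of_real (mangoldt d / d) * (A (x div d) - L_value \<chi>))"
    unfolding mangoldt_sum_upto_def
    by (simp only: right_diff_distrib sum_subtractf sum_distrib_left) (simp add: mult_ac)
  have "norm (\<Sum>d=1..x. \<chi> d * of_real (mangoldt d / d) * (A (x div d) - L_value \<chi>)) \<le>
      (\<Sum>d=1..x. mangoldt d * (2 * real M / real x))"
  proof (rule sum_norm_le)
    fix d assume d: "d \<in> {1..x}"
    have "norm (\<chi> d * of_real (mangoldt d / d) * (A (x div d) - L_value \<chi>)) \<le>
        1 * (mangoldt d / d) * (2 * real M * real d / real x)"
      unfolding norm_mult A_def
      using d x by (intro mult_mono norm_dchars_le[OF \<chi> M] norm_L_value_diff_div_le)
        (auto intro!: mult_nonneg_nonneg divide_nonneg_nonneg mangoldt_nonneg simp: norm_divide mangoldt_nonneg)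
    then show "norm (\<chi> d * of_real (mangoldt d / d) * (A (x div d) - L_value \<chi>)) \<le>
        mangoldt d * (2 * real M / real x)" using d by simp
  qed
  also have "\<dots> = (\<Sum>d=1..x. mangoldt d) * (2 * real M / real x)" by (simp only: sum_distrib_right)
  \<comment> \<open>Chebyshev's bound is linear in \<open>x\<close> and so absorbs the factor
    \<open>1 / x\<close> of the error.\<close>
  also have "\<dots> \<le> 6 * real x * (2 * real M / real x)"
    by (intro mult_right_mono chebyshev_upper) auto
  also have "\<dots> = 12 * real M" using x by simp
  finally have "norm (L_value \<chi> * mangoldt_sum_upto \<chi> x) \<le> (1 + 2 * real M) + 12 * real M"
    unfolding eq using norm_ln_sum_le by (intro norm_triangle_le_diff add_mono)
  then show "norm (mangoldt_sum_upto \<chi> x) \<le> (1 + 14 * real M) / norm (L_value \<chi>)"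
    using assms by (simp add: norm_mult field_simps)
qed

text \<open>
  The identity \<open>\<Sum>\<^bsub>d | n\<^esub> \<mu>(d) ln (x/d) = [n = 1] ln x + \<Lambda>(n)\<close> turns the left-hand side into a sum weighted
  with partial sums of the L-series, which are small when \<open>L(1,\<chi>) = 0\<close>.
\<close>

lemma mangoldt_sum_L_value_0:
  assumes "L_value \<chi> = 0" "x > 0"
  shows "norm (mangoldt_sum_upto \<chi> x + of_real (ln x)) \<le> 2 * real M"
proof -
  define A where "A y = (\<Sum>n=1..y. \<chi> n / of_nat n)" for y
  let ?g = "\<lambda>d m. \<chi> d * of_real (moebius d * ln (x / d) / d) * (\<chi> m / of_nat m)"
  have "mangoldt_sum_upto \<chi> x + of_real (ln x) =
      (\<Sum>n=1..x. \<chi> n * of_real (mangoldt n / n)) + (\<Sum>n=1..x. if n = 1 then of_real (ln x) else 0)"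
    using assms(2) by (simp add: mangoldt_sum_upto_def Suc_le_eq)
  also have "\<dots> = (\<Sum>n=1..x. \<chi> n * of_real (mangoldt n / n) + (if n = 1 then of_real (ln x) else 0))"
    by (simp only: sum.distrib)
  also have "\<dots> = (\<Sum>n=1..x. \<Sum>d | d dvd n. ?g d (n div d))"
  proof (intro sum.cong refl)
    fix n assume n: "n \<in> {1..x}"
    have "(\<Sum>d | d dvd n. ?g d (n div d)) =
      (\<Sum>d | d dvd n. \<chi> n / of_nat n * of_real (ln (x / n) * moebius d + moebius d * ln (real (n div d))))"
    proof (intro sum.cong refl)
      fix d assume "d \<in> {d. d dvd n}"
      then obtain m where m: "n = d * m" by auto
      with n have dm: "d > 0" "m > 0" by (auto intro!: Nat.gr0I)
      have "ln (x / d) = ln (x / n) + ln (real m)"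
        using dm assms(2) by (simp add: m ln_div ln_mult)
      with m dm show "?g d (n div d) =
          \<chi> n / of_nat n * of_real (ln (x / n) * moebius d + moebius d * ln (real (n div d)))"
        by (simp add: dchars_mult[OF \<chi>] field_simps)
    qed
    also have "\<dots> = \<chi> n / of_nat n * of_real (ln (x / n) * (\<Sum>d | d dvd n. moebius d) +
        (\<Sum>d | d dvd n. moebius d * ln (real (n div d))))"
      by (simp only: sum_distrib_left[symmetric] of_real_sum[symmetric] sum.distrib)
    also have "\<dots> = \<chi> n * of_real (mangoldt n / n) + (if n = 1 then of_real (ln x) else 0)"
      using n by (simp add: sum_moebius sum_moebius_ln dchars_Suc_0[OF \<chi>])
    finally show "\<chi> n * of_real (mangoldt n / n) + (if n = 1 then of_real (ln x) else 0) =
        (\<Sum>d | d dvd n. ?g d (n div d))" ..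
  qed
  also have "\<dots> = (\<Sum>d=1..x. \<chi> d * of_real (moebius d * ln (x / d) / d) * A (x div d))"
    unfolding sum_divisors_swap[of ?g] A_def sum_distrib_left ..
  also have "norm \<dots> \<le> (\<Sum>d=1..x. ln (x / d) * (2 * real M / x))"
  proof (rule sum_norm_le)
    fix d assume d: "d \<in> {1..x}"
    then have l: "ln (x / d) \<ge> 0" by (intro ln_ge_zero) auto
    have "norm (complex_of_real (moebius d * ln (x / d) / d)) = \<bar>moebius d\<bar> * (ln (x / d) / d)"
      using l by (simp add: norm_mult norm_divide abs_mult)
    also have "\<dots> \<le> 1 * (ln (x / d) / d)"
      using l abs_moebius_le by (intro mult_right_mono) auto
    finally have "norm (\<chi> d * of_real (moebius d * ln (x / d) / d) * A (x div d)) \<le>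
        1 * (ln (x / d) / d) * (2 * real M * real d / real x)"
      unfolding norm_mult[of _ "A _"] norm_mult[of "\<chi> _"]
      using d l assms norm_L_value_diff_div_le[of d x]
      by (intro mult_mono norm_dchars_le[OF \<chi> M]) (auto simp: A_def)
    then show "norm (\<chi> d * of_real (moebius d * ln (x / d) / d) * A (x div d)) \<le>
        ln (x / d) * (2 * real M / x)" using d by simp
  qed
  also have "\<dots> = (\<Sum>d=1..x. ln (x / d)) * (2 * real M / x)" by (simp only: sum_distrib_right)
  also have "(\<Sum>d=1..x. ln (x / d)) = (\<Sum>d=1..x. ln (real x) - ln (real d))"
    by (intro sum.cong refl) (simp add: ln_div)
  also have "\<dots> = x * ln x - ln (fact x)" by (simp add: sum_subtractf ln_fact_sum)
  also have "\<dots> * (2 * real M / x) \<le> real x * (2 * real M / x)"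
    using ln_fact_ge[OF assms(2)] by (intro mult_right_mono) auto
  finally show ?thesis using assms(2) by simp
qed

end

text \<open>Mertens' estimate, minus the terms not coprime to \<open>M\<close>. The nonprimes among
  these contribute at most 4, and the primes among them are prime factors of
  \<open>M\<close>.\<close>

lemma mangoldt_sum_principal:
  assumes "M > 0"
  shows "\<exists>K. \<forall>x>0. norm (mangoldt_sum_upto (principal_char M) x - of_real (ln x)) \<le> K"
proof (intro exI allI impI)
  fix x :: nat assume x: "x > 0"
  let ?P = "\<lambda>n. coprime n M"
  let ?D = "\<Sum>n | n \<in> {1..x} \<and> \<not> ?P n. mangoldt n / n :: real"
  have "mangoldt_sum_upto (principal_char M) x = of_real (\<Sum>n=1..x. if ?P n then mangoldt n / n else 0)"
    unfolding mangoldt_sum_upto_def of_real_sum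
    by (intro sum.cong refl) (simp add: principal_char_def)
  also have "(\<Sum>n=1..x. if ?P n then mangoldt n / n else 0) = (\<Sum>n=1..x. mangoldt n / n) - ?D"
  proof -
    have "?D = (\<Sum>n=1..x. if \<not> ?P n then mangoldt n / n else 0)"
      by (subst sum.inter_filter[symmetric]) auto
    then show ?thesis by (simp only: sum_subtractf[symmetric]) (auto intro!: sum.cong)
  qed
  finally have eq: "mangoldt_sum_upto (principal_char M) x - of_real (ln x) =
      of_real ((\<Sum>n=1..x. mangoldt n / n) - ln x - ?D)" by simp
  have "?D \<le> (\<Sum>n\<in>{n. n \<in> {1..x} \<and> \<not> prime n} \<union> prime_factors M. mangoldt n / n)"
    using assms
    by (intro sum_mono2)
      (auto intro!: divide_nonneg_nonneg mangoldt_nonneg simp: in_prime_factors_iff coprime_commute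
         dest: prime_imp_coprime)
  also have "\<dots> \<le> (\<Sum>n\<in>{n. n \<in> {1..x} \<and> \<not> prime n}. mangoldt n / n) + (\<Sum>n\<in>prime_factors M. mangoldt n / n)"
    by (subst sum.union_disjoint) auto
  also have "\<dots> \<le> 4 + (\<Sum>n\<in>prime_factors M. mangoldt n / n)"
    using sum_mangoldt_nonprime_le[of x] by simp
  finally have D: "?D \<le> 4 + (\<Sum>n\<in>prime_factors M. mangoldt n / n)" .
  have "?D \<ge> 0" by (intro sum_nonneg divide_nonneg_nonneg mangoldt_nonneg) auto
  with D have "\<bar>(\<Sum>n=1..x. mangoldt n / n) - ln x - ?D\<bar> \<le> 10 + (\<Sum>n\<in>prime_factors M. mangoldt n / n)"
    using mertens_lower[OF x] mertens_upper[OF x] by linarith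
  then show "norm (mangoldt_sum_upto (principal_char M) x - of_real (ln x)) \<le>
      10 + (\<Sum>n\<in>prime_factors M. mangoldt n / n)"
    unfolding eq norm_of_real .
qed

section \<open>Nonvanishing for real characters\<close>

lemma sum_divisors_coprime_mult:
  fixes f :: "nat \<Rightarrow> 'a::comm_semiring_0"
  assumes "coprime a b" and mult: "\<And>m n. f (m * n) = f m * f n"
  shows "(\<Sum>d | d dvd a * b. f d) = (\<Sum>d | d dvd a. f d) * (\<Sum>d | d dvd b. f d)"
proof -
  have inj: "inj_on (\<lambda>(d, e). d * e) ({d. d dvd a} \<times> {e. e dvd b})"
  proof (rule inj_onI, clarify)
    fix d e d' e' assume h: "d dvd a" "e dvd b" "d' dvd a" "e' dvd b" "d * e = d' * e'"
    have c: "coprime u v" if "u dvd a" "v dvd b" for u v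
      using coprime_divisors[OF that assms(1)] .
    have "d dvd d' * e'" "d' dvd d * e" "e dvd d' * e'" "e' dvd d * e"
      using h(5) by (metis dvd_triv_left dvd_triv_right)+
    then have "d dvd d'" "d' dvd d" "e dvd e'" "e' dvd e"
      using c h by (meson coprime_dvd_mult_left_iff coprime_dvd_mult_right_iff coprime_commute)+
    then show "d = d' \<and> e = e'" by (simp add: dvd_antisym)
  qed
  have "(\<lambda>(d, e). d * e) ` ({d. d dvd a} \<times> {e. e dvd b}) = {d. d dvd a * b}"
    by (auto intro: mult_dvd_mono dest!: division_decomp)
  then have "(\<Sum>d | d dvd a * b. f d) = (\<Sum>(d, e)\<in>{d. d dvd a} \<times> {e. e dvd b}. f d * f e)"
    using sum.reindex[OF inj, of f] by (simp add: o_def case_prod_unfold mult)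
  also have "\<dots> = (\<Sum>d | d dvd a. f d) * (\<Sum>d | d dvd b. f d)"
    by (simp add: sum_product sum.cartesian_product)
  finally show ?thesis .
qed

text \<open>The divisor sum is multiplicative. At \<open>p ^ j\<close> it is a geometric sum with
  ratio -1, 0 or 1, hence nonnegative, and at least 1 for even \<open>j\<close>.\<close>

lemma sum_divisors_real_char:
  fixes f :: "nat \<Rightarrow> real"
  assumes mult: "\<And>m n. f (m * n) = f m * f n" and one: "f 1 = 1"
    and vals: "\<And>n. f n \<in> {-1, 0, 1}" and "n > 0"
  shows "(\<Sum>d | d dvd n. f d) \<ge> 0 \<and> (\<Sum>d | d dvd n\<^sup>2. f d) \<ge> 1"
  using \<open>n > 0\<close>
proof (induction n rule: less_induct)
  case (less n)
  show ?case
  proof (cases "n = 1")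
    case False
    then obtain p where p: "prime p" "p dvd n" using prime_factor_nat by blast
    define k where "k = multiplicity p n"
    obtain m where m: "n = p ^ k * m" "\<not> p dvd m"
      using multiplicity_decompose'[of n p] less.prems p(1) unfolding k_def by (metis not_prime_unit neq0_conv)
    have "k > 0" using p m(1,2) by (cases k) auto
    have m0: "m > 0" using m(1) less.prems by (auto intro!: Nat.gr0I)
    have "p ^ k > 1" using one_less_power[OF prime_gt_1_nat[OF p(1)] \<open>k > 0\<close>] .
    then have "m < n" using m(1) m0 by simp
    have pk: "(\<Sum>d | d dvd p ^ j. f d) = (\<Sum>i\<le>j. f p ^ i)" for j
    proof -
      have fp: "f (p ^ i) = f p ^ i" for i using one by (induction i) (simp_all add: mult)
      have "{d. d dvd p ^ j} = (\<lambda>i. p ^ i) ` {..j}"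
        using divides_primepow_nat[OF p(1)] by auto
      moreover have "inj_on (\<lambda>i. p ^ i) {..j}"
        using prime_gt_1_nat[OF p(1)] by (intro inj_onI) (simp add: power_inject_exp)
      ultimately show ?thesis by (simp add: sum.reindex fp)
    qed
    have alt: "(\<Sum>i\<le>j. (-1) ^ i) = (if even j then 1 else 0 :: real)" for j :: nat
      by (induction j) auto
    have zero: "(\<Sum>i\<le>j. 0 ^ i) = (1 :: real)" for j :: nat
      by (induction j) auto
    have "(\<Sum>i\<le>j. f p ^ i) \<ge> 0 \<and> (even j \<longrightarrow> (\<Sum>i\<le>j. f p ^ i) \<ge> 1)" for j
      using vals[of p] by (auto simp: alt zero)
    then have 1: "(\<Sum>d | d dvd p ^ k. f d) \<ge> 0" "(\<Sum>d | d dvd p ^ (2 * k). f d) \<ge> 1"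
      unfolding pk by auto
    have IH: "(\<Sum>d | d dvd m. f d) \<ge> 0" "(\<Sum>d | d dvd m\<^sup>2. f d) \<ge> 1"
      using less.IH[OF \<open>m < n\<close> m0] by auto
    have "coprime p m" using p(1) m(2) by (rule prime_imp_coprime)
    then have "(\<Sum>d | d dvd p ^ k * m. f d) = (\<Sum>d | d dvd p ^ k. f d) * (\<Sum>d | d dvd m. f d)"
        "(\<Sum>d | d dvd p ^ (2 * k) * m\<^sup>2. f d) = (\<Sum>d | d dvd p ^ (2 * k). f d) * (\<Sum>d | d dvd m\<^sup>2. f d)"
      by (auto intro!: sum_divisors_coprime_mult mult)
    moreover have "n\<^sup>2 = p ^ (2 * k) * m\<^sup>2"
      by (simp add: m(1) power_mult_distrib power_mult power2_eq_square mult_2 power_add)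
    ultimately show ?thesis
      using mult_nonneg_nonneg[OF 1(1) IH(1)] mult_mono[OF 1(2) IH(2)] 1(2) m(1) by simp
  qed (use one in simp)
qed

text \<open>This inequality is what makes the Lambert weights decrease.\<close>

lemma geometric_product_ge:
  fixes t :: real
  assumes t: "0 < t" "t < 1"
  shows "real n * (real n + 1) * t ^ n \<le> (\<Sum>i<n. t ^ i) * (\<Sum>i<Suc n. t ^ i)"
proof -
  \<comment> \<open>AM-GM on \<open>t\<^sup>i\<close> and \<open>t\<^bsup>n-1-i\<^esup>\<close>; the square root avoids half-integral powers of \<open>t\<close>.\<close>
  define u where "u = sqrt t"
  have u: "0 < u" "u < 1" "t = u\<^sup>2" using t by (auto simp: u_def)
  have ge: "real n * u ^ (n - 1) \<le> (\<Sum>i<n. t ^ i)" for n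
  proof -
    have "2 * (real n * u ^ (n - 1)) = (\<Sum>i<n. 2 * u ^ (n - 1))" by simp
    also have "\<dots> \<le> (\<Sum>i<n. t ^ i + t ^ (n - Suc i))"
    proof (rule sum_mono)
      fix i assume i: "i \<in> {..<n}"
      then have "u ^ (n - 1) = u ^ i * u ^ (n - Suc i)" by (simp flip: power_add)
      moreover have "2 * u ^ i * u ^ (n - Suc i) \<le> (u ^ i)\<^sup>2 + (u ^ (n - Suc i))\<^sup>2"
        by (rule sum_squares_bound)
      ultimately show "2 * u ^ (n - 1) \<le> t ^ i + t ^ (n - Suc i)"
        by (simp add: u(3) mult.assoc flip: power_mult) (simp add: mult.commute)
    qed
    also have "\<dots> = 2 * (\<Sum>i<n. t ^ i)"
      by (simp add: sum.distrib sum.nat_diff_reindex)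
    finally show ?thesis by simp
  qed
  show ?thesis
  proof (cases "n = 0")
    case False
    have "t ^ n = u ^ (2 * n)" by (simp add: u(3) power_mult)
    also have "\<dots> \<le> u ^ ((n - 1) + n)" using u by (intro power_decreasing) auto
    finally have "real n * (real n + 1) * t ^ n \<le> real n * (real n + 1) * u ^ ((n - 1) + n)"
      by (intro mult_left_mono) auto
    also have "\<dots> = (real n * u ^ (n - 1)) * (real (Suc n) * u ^ (Suc n - 1))"
      by (simp add: power_add mult_ac)
    also have "\<dots> \<le> (\<Sum>i<n. t ^ i) * (\<Sum>i<Suc n. t ^ i)"
      using u t by (intro mult_mono ge) (auto intro!: sum_nonneg)
    finally show ?thesis .
  qed simp
qed

text \<open>
  If \<open>L(1,\<chi>) = 0\<close>, subtracting the vanishing series of \<open>\<chi>(n) / (n (1 - t))\<close> from the Lambert series leaves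
  weights that decrease in \<open>n\<close> and start with \<open>1\<close>, so that the result is bounded uniformly in \<open>t\<close>.
\<close>

definition lambert_weight :: "real \<Rightarrow> nat \<Rightarrow> real" where
  "lambert_weight t n = 1 / (real n * (1 - t)) - t ^ n / (1 - t ^ n)"

lemma lambert_weight_eq:
  assumes "0 < t" "t < 1"
  shows "lambert_weight t n = (1 / n - t ^ n / (\<Sum>i<n. t ^ i)) / (1 - t)"
proof -
  have "1 - t ^ n = (1 - t) * (\<Sum>i<n. t ^ i)"
    using one_diff_power_eq[of t n] by simp
  then show ?thesis using assms by (simp add: lambert_weight_def diff_divide_distrib)
qed

lemma lambert_weight_nonneg:
  assumes t: "0 < t" "t < 1" and "n > 0"
  shows "lambert_weight t n \<ge> 0"
proof -
  have pos: "(\<Sum>i<n. t ^ i) > 0" using assms by (intro sum_pos) auto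
  have "(\<Sum>i<n. t ^ n) \<le> (\<Sum>i<n. t ^ i)" using t by (intro sum_mono power_decreasing) auto
  then have "t ^ n / (\<Sum>i<n. t ^ i) \<le> 1 / n" using pos assms by (simp add: field_simps)
  then show ?thesis using t by (simp add: lambert_weight_eq)
qed

lemma lambert_weight_decreasing:
  assumes t: "0 < t" "t < 1" and n: "n > 0"
  shows "lambert_weight t (Suc n) \<le> lambert_weight t n"
proof -
  define G where "G n = (\<Sum>i<n. t ^ i)" for n
  have pos: "G m > 0" if "m > 0" for m unfolding G_def using t that by (intro sum_pos) auto
  \<comment> \<open>This recursion collapses the difference of consecutive quotients
    \<open>t ^ n / G n\<close> to \<open>t ^ n / (G n * G (Suc n))\<close>, which is compared with
    \<open>1 / n - 1 / (n + 1)\<close>.\<close>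
  have G_Suc: "G (Suc n) = 1 + t * G n"
    unfolding G_def sum.lessThan_Suc_shift by (simp add: sum_distrib_left)
  have "t ^ n / G n - t ^ Suc n / G (Suc n) = t ^ n * (G (Suc n) - t * G n) / (G n * G (Suc n))"
    using pos[of n] pos[of "Suc n"] n by (simp add: field_simps)
  also have "\<dots> = t ^ n / (G n * G (Suc n))" by (simp add: G_Suc)
  also have "\<dots> \<le> 1 / (real n * (real n + 1))"
  proof -
    have "u / g \<le> 1 / q" if "q * u \<le> g" "q > 0" "g > 0" for u g q :: real
      using that by (simp add: field_simps)
    then show ?thesis
      using geometric_product_ge[OF t, of n] pos[of n] pos[of "Suc n"] n
      by (simp only: G_def[symmetric]) simp
  qed
  also have "\<dots> = 1 / n - 1 / Suc n" using n by (simp add: field_simps)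
  finally have "1 / Suc n - t ^ Suc n / G (Suc n) \<le> 1 / n - t ^ n / G n" by simp
  then show ?thesis using t
    unfolding lambert_weight_eq[OF t] G_def[symmetric] by (intro divide_right_mono) auto
qed

text \<open>The tail of the geometric series starts at exponent
  \<open>d * (X div d + 1) \<ge> X\<close>, which gives an error bound uniform in
  \<open>d\<close>.\<close>

lemma lambert_truncation:
  fixes t :: real
  assumes t: "0 < t" "t < 1" and d: "d > 0"
  shows "\<bar>(\<Sum>k=1..X div d. t ^ (d * k)) - t ^ d / (1 - t ^ d)\<bar> \<le> t ^ X / (1 - t)"
proof -
  define K where "K = X div d"
  have td: "t ^ d \<le> t" "0 < t ^ d" using t d power_decreasing[of 1 d t] by auto
  have "(1 - t ^ d) * (\<Sum>k=1..K. (t ^ d) ^ k) = t ^ d - (t ^ d) ^ Suc K"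
  proof (cases "K = 0")
    case False
    then show ?thesis using sum_gp_multiplied[of 1 K "t ^ d"] by simp
  qed simp
  then have "(\<Sum>k=1..K. t ^ (d * k)) - t ^ d / (1 - t ^ d) = - (t ^ (d * Suc K) / (1 - t ^ d))"
  proof -
    have "s - a / (1 - a) = - (b / (1 - a))" if "(1 - a) * s = a - b" "a < 1" for a b s :: real
    proof -
      have "s = (a - b) / (1 - a)"
        using that nonzero_eq_divide_eq[of "1 - a" s "a - b"] by (simp add: mult.commute)
      then show ?thesis by (simp add: diff_divide_distrib)
    qed
    moreover assume "(1 - t ^ d) * (\<Sum>k=1..K. (t ^ d) ^ k) = t ^ d - (t ^ d) ^ Suc K"
    ultimately show ?thesis using t td by (simp only: power_mult)
  qed
  moreover have "X \<le> d * Suc K"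
    using dividend_less_times_div[OF d, of X] by (simp add: K_def)
  then have "t ^ (d * Suc K) / (1 - t ^ d) \<le> t ^ X / (1 - t)"
    using t td by (intro frac_le power_decreasing) auto
  moreover have "t ^ (d * Suc K) / (1 - t ^ d) \<ge> 0" using t td by simp
  ultimately show ?thesis unfolding K_def by linarith
qed

context nonprincipal_char
begin

text \<open>For fixed \<open>t\<close> the first and the last term of the bound vanish as
  \<open>X\<close> grows, which leaves \<open>2 * real M\<close>, independent of
  \<open>t\<close>.\<close>

lemma lambert_sum_le:
  assumes real: "\<And>n. \<chi> n \<in> \<real>" and L: "L_value \<chi> = 0" and t: "0 < t" "t < 1"
  shows "(\<Sum>m=1..X. (\<Sum>d | d dvd m. Re (\<chi> d)) * t ^ m) \<le>
    2 * real M / (real X + 1) / (1 - t) + 2 * real M + real X * t ^ X / (1 - t)"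
proof -
  have "(\<Sum>m=1..X. (\<Sum>d | d dvd m. Re (\<chi> d)) * t ^ m) =
      (\<Sum>m=1..X. \<Sum>d | d dvd m. Re (\<chi> d) * t ^ (d * (m div d)))"
    unfolding sum_distrib_right by (intro sum.cong refl) simp
  also have "\<dots> = (\<Sum>d=1..X. Re (\<chi> d) * (\<Sum>k=1..X div d. t ^ (d * k)))"
    unfolding sum_distrib_left using sum_divisors_swap[of "\<lambda>d k. Re (\<chi> d) * t ^ (d * k)" X] .
  also have "\<dots> \<le> (\<Sum>d=1..X. Re (\<chi> d) * (t ^ d / (1 - t ^ d)) + t ^ X / (1 - t))"
  proof (rule sum_mono)
    fix d assume d: "d \<in> {1..X}"
    have "\<bar>Re (\<chi> d)\<bar> \<le> 1"
      using abs_Re_le_cmod norm_dchars_le[OF \<chi> M] order_trans by blast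
    then have "\<bar>Re (\<chi> d) * ((\<Sum>k=1..X div d. t ^ (d * k)) - t ^ d / (1 - t ^ d))\<bar> \<le> 1 * (t ^ X / (1 - t))"
      unfolding abs_mult using lambert_truncation[OF t, of d X] d by (intro mult_mono) auto
    then show "Re (\<chi> d) * (\<Sum>k=1..X div d. t ^ (d * k)) \<le>
        Re (\<chi> d) * (t ^ d / (1 - t ^ d)) + t ^ X / (1 - t)"
      by (simp add: right_diff_distrib)
  qed
  also have "\<dots> = (\<Sum>d=1..X. Re (\<chi> d) * (t ^ d / (1 - t ^ d))) + real X * t ^ X / (1 - t)"
    by (simp add: sum.distrib)
  \<comment> \<open>The definition of the weight, solved for
    \<open>t ^ d / (1 - t ^ d)\<close>.\<close>
  also have "(\<Sum>d=1..X. Re (\<chi> d) * (t ^ d / (1 - t ^ d))) =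
      (\<Sum>d=1..X. Re (\<chi> d / of_nat d / of_real (1 - t)) - Re (of_real (lambert_weight t d) * \<chi> d))"
  proof (intro sum.cong refl)
    fix d
    have *: "R * v = R * u - (u - v) * R" for R u v :: real by (simp add: algebra_simps)
    have "Re (\<chi> d / of_nat d / of_real (1 - t)) = Re (\<chi> d) * (1 / (real d * (1 - t)))"
      by (simp only: Re_divide_of_real Re_divide_of_nat) simp
    moreover have "Re (of_real (lambert_weight t d) * \<chi> d) = lambert_weight t d * Re (\<chi> d)" by simp
    ultimately show "Re (\<chi> d) * (t ^ d / (1 - t ^ d)) =
        Re (\<chi> d / of_nat d / of_real (1 - t)) - Re (of_real (lambert_weight t d) * \<chi> d)"
      unfolding lambert_weight_def using * by metis
  qed
  also have "\<dots> = Re ((\<Sum>d=1..X. \<chi> d / of_nat d) / of_real (1 - t)) -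
      Re (\<Sum>d=1..<Suc X. of_real (lambert_weight t d) * \<chi> d)"
    by (simp only: sum_subtractf Re_sum[symmetric] sum_divide_distrib[symmetric] atLeastLessThanSuc_atLeastAtMost)
  also have "\<dots> \<le> norm ((\<Sum>d=1..X. \<chi> d / of_nat d) / complex_of_real (1 - t)) +
      norm (\<Sum>d=1..<Suc X. of_real (lambert_weight t d) * \<chi> d)"
    using abs_Re_le_cmod[of "(\<Sum>d=1..X. \<chi> d / of_nat d) / complex_of_real (1 - t)"]
      abs_Re_le_cmod[of "\<Sum>d=1..<Suc X. of_real (lambert_weight t d) * \<chi> d"] by linarith
  also have "\<dots> \<le> 2 * real M / (real X + 1) / (1 - t) + 2 * real M"
  proof (rule add_mono)
    have "norm ((\<Sum>d=1..X. \<chi> d / of_nat d) / complex_of_real (1 - t)) =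
        norm (\<Sum>d=1..X. \<chi> d / of_nat d) / (1 - t)"
      using t by (simp only: norm_divide norm_of_real)
    then show "norm ((\<Sum>d=1..X. \<chi> d / of_nat d) / complex_of_real (1 - t)) \<le>
        2 * real M / (real X + 1) / (1 - t)"
      using norm_L_value_diff_le[of X] t by (simp only: L) (intro divide_right_mono, auto)
    have "lambert_weight t 1 = 1" using t by (simp add: lambert_weight_def flip: diff_divide_distrib)
    then show "norm (\<Sum>d=1..<Suc X. of_real (lambert_weight t d) * \<chi> d) \<le> 2 * real M"
      using norm_weighted_sum_le[of 1 "lambert_weight t" "Suc X"]
        lambert_weight_decreasing[OF t] lambert_weight_nonneg[OF t] by simp
  qed
  finally show ?thesis by simp
qed

text \<open>The coefficients \<open>c m\<close> of the Lambert series are nonnegative, and at least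
  1 at squares. If the L-value were 0, the sums of \<open>t ^ (j^2)\<close> would stay below a
  constant as \<open>t\<close> tends to 1.\<close>

lemma L_value_real_nonzero:
  assumes real: "\<And>n. \<chi> n \<in> \<real>"
  shows "L_value \<chi> \<noteq> 0"
proof
  assume L: "L_value \<chi> = 0"
  define c where "c m = (\<Sum>d | d dvd m. Re (\<chi> d))" for m
  have \<chi>_Re: "\<chi> n = of_real (Re (\<chi> n))" for n using real[of n] by simp
  have "Re (\<chi> (m * n)) = Re (\<chi> m) * Re (\<chi> n)" for m n
    using dchars_mult[OF \<chi>, of m n] \<chi>_Re[of m] \<chi>_Re[of n] by (metis Re_complex_of_real of_real_mult)
  moreover have "Re (\<chi> 1) = 1" using dchars_1[OF \<chi>] by simp
  moreover have "Re (\<chi> n) \<in> {-1, 0, 1}" for n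
  proof (cases "coprime n M")
    case True
    then have "\<bar>Re (\<chi> n)\<bar> = 1" using norm_dchars[OF \<chi> M True] \<chi>_Re[of n] by (metis norm_of_real)
    then show ?thesis by auto
  qed (use dchars_eq_0_iff[OF \<chi>, of n] in simp)
  ultimately have c: "c m \<ge> 0" "c (m\<^sup>2) \<ge> 1" if "m > 0" for m
    using sum_divisors_real_char[of "\<lambda>n. Re (\<chi> n)" m] that unfolding c_def by auto
  \<comment> \<open>One square more than the bound \<open>2 * real M\<close> permits in the limit
    \<open>t = 1\<close>.\<close>
  define K where "K = 2 * M + 1"
  have bound: "(\<Sum>j=1..K. t ^ (j\<^sup>2)) \<le> 2 * real M" if t: "0 < t" "t < 1" for t :: real
  proof (rule LIMSEQ_le_const)
    have 1: "(\<lambda>X. real X * t ^ X) \<longlonglongrightarrow> 0"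
      using powser_times_n_limit_0[of t] t by simp
    have 2: "(\<lambda>X. 2 * real M / (real X + 1)) \<longlonglongrightarrow> 0"
      using tendsto_mult_right_zero[OF LIMSEQ_inverse_real_of_nat, of "2 * real M"]
      by (simp add: divide_inverse add.commute)
    have "(\<lambda>X. 2 * real M / (real X + 1) / (1 - t) + 2 * real M + real X * t ^ X / (1 - t)) \<longlonglongrightarrow>
        0 / (1 - t) + 2 * real M + 0 / (1 - t)"
      using t by (intro tendsto_intros 1 2) auto
    then show "(\<lambda>X. 2 * real M / (real X + 1) / (1 - t) + 2 * real M + real X * t ^ X / (1 - t)) \<longlonglongrightarrow> 2 * real M"
      by simp
    have "(\<Sum>j=1..K. t ^ (j\<^sup>2)) \<le> 2 * real M / (real X + 1) / (1 - t) + 2 * real M + real X * t ^ X / (1 - t)"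
      if X: "X \<ge> K\<^sup>2" for X
    proof -
      have "(\<Sum>j=1..K. t ^ (j\<^sup>2)) \<le> (\<Sum>j=1..K. c (j\<^sup>2) * t ^ (j\<^sup>2))"
        using c t by (intro sum_mono) (auto simp: mult_le_cancel_right1)
      also have "\<dots> = (\<Sum>m\<in>(\<lambda>j. j\<^sup>2) ` {1..K}. c m * t ^ m)"
        by (subst sum.reindex) (auto simp: inj_on_def)
      also have "\<dots> \<le> (\<Sum>m=1..X. c m * t ^ m)"
      proof (intro sum_mono2)
        show "(\<lambda>j. j\<^sup>2) ` {1..K} \<subseteq> {1..X}"
          using X by (auto intro: order_trans[OF power_mono])
      qed (use c t in auto)
      finally show ?thesis using lambert_sum_le[OF real L t, of X] unfolding c_def by simp
    qed
    then show "\<exists>N. \<forall>X\<ge>N. (\<Sum>j=1..K. t ^ (j\<^sup>2)) \<le>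
        2 * real M / (real X + 1) / (1 - t) + 2 * real M + real X * t ^ X / (1 - t)" by blast
  qed
  have "((\<lambda>t::real. \<Sum>j=1..K. t ^ (j\<^sup>2)) \<longlongrightarrow> (\<Sum>j=1..K. 1 ^ (j\<^sup>2))) (at_left 1)"
    by (intro tendsto_intros)
  moreover have "eventually (\<lambda>t::real. (\<Sum>j=1..K. t ^ (j\<^sup>2)) \<le> 2 * real M) (at_left 1)"
    using eventually_at_left_real[of 0 "1::real"] by (rule eventually_mono) (use bound in auto)
  ultimately have "(\<Sum>j=1..K. (1::real) ^ (j\<^sup>2)) \<le> 2 * real M"
    by (intro tendsto_upperbound[where F = "at_left (1::real)"]) auto
  then show False by (simp add: K_def)
qed

end

section \<open>Primes in arithmetic progressions\<close>

lemma mangoldt_sum_upto_asymp: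
  assumes "M > 0" "\<chi> \<in> dchars M"
  shows "\<exists>K. \<forall>x>0. norm (mangoldt_sum_upto \<chi> x -
    (if \<chi> = principal_char M then 1 else if L_value \<chi> = 0 then -1 else 0) * of_real (ln x)) \<le> K"
proof (cases "\<chi> = principal_char M")
  case True
  then show ?thesis using mangoldt_sum_principal[OF assms(1)] by simp
next
  case False
  then interpret nonprincipal_char M \<chi> using assms by unfold_locales auto
  show ?thesis using False mangoldt_sum_bounded mangoldt_sum_L_value_0 by auto
qed

text \<open>Weighting by \<open>\<chi> b\<close> selects the residue class of the inverse of
  \<open>b\<close>, so orthogonality applies to \<open>\<chi> (b * n)\<close> directly.\<close>

lemma sum_dchars_mangoldt_sum_upto:
  assumes "squarefree M" "coprime b M"
  shows "(\<Sum>\<chi>\<in>dchars M. \<chi> b * mangoldt_sum_upto \<chi> x) =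
    of_real (card (dchars M) * (\<Sum>n | n \<in> {1..x} \<and> [b * n = 1] (mod M). mangoldt n / n))"
proof -
  have *: "(\<Sum>\<chi>\<in>dchars M. \<chi> (b * n)) = (if [b * n = 1] (mod M) then of_nat (card (dchars M)) else 0)" for n
  proof (cases "coprime (b * n) M")
    case False
    then have "\<chi> (b * n) = 0" if "\<chi> \<in> dchars M" for \<chi>
      using dchars_eq_0_iff[OF that] by blast
    moreover have "\<not> [b * n = 1] (mod M)"
      using False cong_imp_coprime cong_sym coprime_1_left by blast
    ultimately show ?thesis by (simp add: sum.neutral)
  qed (rule dchars_orthogonality[OF assms(1)])
  have "(\<Sum>\<chi>\<in>dchars M. \<chi> b * mangoldt_sum_upto \<chi> x) =
      (\<Sum>\<chi>\<in>dchars M. \<Sum>n=1..x. \<chi> (b * n) * of_real (mangoldt n / n))"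
    unfolding mangoldt_sum_upto_def sum_distrib_left
    by (intro sum.cong refl) (simp add: dchars_mult)
  also have "\<dots> = (\<Sum>n=1..x. (\<Sum>\<chi>\<in>dchars M. \<chi> (b * n)) * of_real (mangoldt n / n))"
    unfolding sum_distrib_right by (rule sum.swap)
  also have "\<dots> = (\<Sum>n=1..x. if [b * n = 1] (mod M) then of_nat (card (dchars M)) * of_real (mangoldt n / n) else 0)"
    unfolding * by (intro sum.cong refl) simp
  also have "\<dots> = (\<Sum>n | n \<in> {1..x} \<and> [b * n = 1] (mod M). of_nat (card (dchars M)) * of_real (mangoldt n / n))"
    by (subst sum.inter_filter[symmetric]) auto
  finally show ?thesis by (simp add: sum_distrib_left)
qed

lemma exists_ln_greater:
  fixes C :: real
  obtains x :: nat where "x > 0" "ln (real x) > C"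
proof -
  obtain x :: nat where x: "real x > exp C" using reals_Archimedean2 by blast
  then have "real x > 0" using exp_gt_zero order_less_trans by blast
  with x have "ln (real x) > C" by (metis exp_gt_zero ln_exp ln_less_cancel_iff)
  with \<open>real x > 0\<close> that show ?thesis by auto
qed

text \<open>For the class of 1 the sum over all characters is nonnegative, yet two distinct zeros
  would make its coefficient of \<open>ln x\<close> at most \<open>1 - 1 - 1 = -1\<close>.\<close>

lemma L_value_zero_unique:
  assumes sf: "squarefree M"
    and "\<chi> \<in> dchars M" "\<chi> \<noteq> principal_char M" "L_value \<chi> = 0"
    and "\<psi> \<in> dchars M" "\<psi> \<noteq> principal_char M" "L_value \<psi> = 0"
  shows "\<chi> = \<psi>"
proof (rule ccontr)
  assume "\<chi> \<noteq> \<psi>"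
  have M: "M > 0" using sf by (cases "M = 0") auto
  define c :: "(nat \<Rightarrow> complex) \<Rightarrow> real" where
    "c \<chi> = (if \<chi> = principal_char M then 1 else if L_value \<chi> = 0 then -1 else 0)" for \<chi>
  have "\<forall>\<chi>\<in>dchars M. \<exists>K. \<forall>x>0. norm (mangoldt_sum_upto \<chi> x - of_real (c \<chi>) * of_real (ln x)) \<le> K"
  proof
    fix \<chi> assume "\<chi> \<in> dchars M"
    moreover have "complex_of_real (c \<chi>) =
        (if \<chi> = principal_char M then 1 else if L_value \<chi> = 0 then -1 else 0)"
      by (simp add: c_def)
    ultimately show "\<exists>K. \<forall>x>0. norm (mangoldt_sum_upto \<chi> x - of_real (c \<chi>) * of_real (ln x)) \<le> K"
      using mangoldt_sum_upto_asymp[OF M] by simp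
  qed
  then obtain K where K: "norm (mangoldt_sum_upto \<chi> x - of_real (c \<chi>) * of_real (ln x)) \<le> K \<chi>"
    if "\<chi> \<in> dchars M" "x > 0" for \<chi> x by metis
  have le: "Re (mangoldt_sum_upto \<chi> x) \<le> c \<chi> * ln x + K \<chi>" if "\<chi> \<in> dchars M" "x > 0" for \<chi> x
    using order_trans[OF complex_Re_le_cmod K[OF that]] by simp
  have "(\<Sum>\<chi>\<in>dchars M. c \<chi>) \<le> -1"
  proof -
    let ?S = "{principal_char M, \<chi>, \<psi>}"
    have "(\<Sum>\<chi>\<in>dchars M. c \<chi>) = sum c ?S + sum c (dchars M - ?S)"
      using assms principal_in_dchars[OF M] finite_dchars[OF M]
      by (subst sum.subset_diff[of ?S]) auto
    also have "sum c (dchars M - ?S) \<le> 0" by (intro sum_nonpos) (auto simp: c_def)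
    also have "sum c ?S = -1" using assms \<open>\<chi> \<noteq> \<psi>\<close> by (auto simp: c_def)
    finally show ?thesis by simp
  qed
  then have "ln (real x) \<le> (\<Sum>\<chi>\<in>dchars M. K \<chi>)" if x: "x > 0" for x :: nat
  proof -
    have "(\<Sum>\<chi>\<in>dchars M. c \<chi>) * ln x \<le> -1 * ln x"
      using x \<open>(\<Sum>\<chi>\<in>dchars M. c \<chi>) \<le> -1\<close> by (intro mult_right_mono) auto
    have "(\<Sum>\<chi>\<in>dchars M. mangoldt_sum_upto \<chi> x) = (\<Sum>\<chi>\<in>dchars M. \<chi> 1 * mangoldt_sum_upto \<chi> x)"
      by (intro sum.cong refl) (simp add: dchars_Suc_0)
    also have "\<dots> = of_real (card (dchars M) * (\<Sum>n | n \<in> {1..x} \<and> [1 * n = 1] (mod M). mangoldt n / n))"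
      by (rule sum_dchars_mangoldt_sum_upto[OF sf]) simp
    finally have "Re (\<Sum>\<chi>\<in>dchars M. mangoldt_sum_upto \<chi> x) =
        card (dchars M) * (\<Sum>n | n \<in> {1..x} \<and> [1 * n = 1] (mod M). mangoldt n / n)" by simp
    also have "\<dots> \<ge> 0"
      by (intro mult_nonneg_nonneg sum_nonneg divide_nonneg_nonneg mangoldt_nonneg) auto
    finally have "0 \<le> (\<Sum>\<chi>\<in>dchars M. Re (mangoldt_sum_upto \<chi> x))" by simp
    also have "\<dots> \<le> (\<Sum>\<chi>\<in>dchars M. c \<chi> * ln x + K \<chi>)" by (intro sum_mono le x)
    also have "\<dots> = (\<Sum>\<chi>\<in>dchars M. c \<chi>) * ln x + (\<Sum>\<chi>\<in>dchars M. K \<chi>)"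
      by (simp add: sum.distrib sum_distrib_right)
    finally show ?thesis using \<open>(\<Sum>\<chi>\<in>dchars M. c \<chi>) * ln x \<le> -1 * ln x\<close> by simp
  qed
  then show False using exists_ln_greater not_less by metis
qed

text \<open>The conjugate character has the conjugate L-value. By uniqueness of the zero the two
  characters agree, so \<open>\<chi>\<close> is real.\<close>

lemma L_value_nonzero:
  assumes "squarefree M" and char: "\<chi> \<in> dchars M" "\<chi> \<noteq> principal_char M"
  shows "L_value \<chi> \<noteq> 0"
proof
  assume L: "L_value \<chi> = 0"
  have "M > 0" using assms(1) by (cases "M = 0") auto
  then interpret nonprincipal_char M \<chi> using char by unfold_locales
  let ?\<psi> = "\<lambda>n. cnj (\<chi> n)"
  have "(\<lambda>n. cnj (\<chi> n / of_nat n)) sums cnj (L_value \<chi>)"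
    unfolding L_value_def sums_cnj by (rule summable_sums[OF summable_L_value])
  then have "(\<lambda>n. cnj (\<chi> n) / of_nat n) sums 0" using L by simp
  then have "L_value ?\<psi> = 0" unfolding L_value_def by (rule sums_unique[symmetric])
  moreover have "?\<psi> \<noteq> principal_char M"
  proof
    assume "?\<psi> = principal_char M"
    then have "cnj (\<chi> n) = principal_char M n" for n by metis
    then have "\<chi> n = principal_char M n" for n
      by (metis complex_cnj_cnj complex_cnj_one complex_cnj_zero of_bool_def principal_char_def)
    with nonprincipal show False by blast
  qed
  ultimately have "\<chi> = ?\<psi>"
    using L_value_zero_unique[OF assms(1) char L cnj_in_dchars[OF char(1)]] by blast
  then have "\<chi> n \<in> \<real>" for n by (metis Reals_cnj_iff)
  with L_value_real_nonzero L show False by blast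
qed

text \<open>Only the principal character contributes a multiple of \<open>ln x\<close>, so the
  \<open>mangoldt\<close> sum over the class is unbounded. With finitely many primes in the class it
  would be bounded, since nonprimes add at most 4.\<close>

theorem dirichlet_primes_squarefree_modulus:
  fixes M a :: nat
  assumes sf: "squarefree M" and a: "coprime a M"
  shows "infinite {p. prime p \<and> [p = a] (mod M)}"
proof
  let ?P = "{p. prime p \<and> [p = a] (mod M)}"
  assume fin: "finite ?P"
  have M: "M > 0" using sf by (cases "M = 0") auto
  obtain b where ab: "[a * b = 1] (mod M)" using cong_solve_coprime_nat a by (metis One_nat_def)
  then have b: "coprime b M" using coprime_iff_invertible_nat by (metis One_nat_def mult.commute)
  have "\<forall>\<chi>\<in>dchars M. \<exists>K. \<forall>x>0. norm (mangoldt_sum_upto \<chi> x - of_bool (\<chi> = principal_char M) * of_real (ln x)) \<le> K"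
  proof
    fix \<chi> assume "\<chi> \<in> dchars M"
    then show "\<exists>K. \<forall>x>0. norm (mangoldt_sum_upto \<chi> x - of_bool (\<chi> = principal_char M) * of_real (ln x)) \<le> K"
      using mangoldt_sum_upto_asymp[OF M, of \<chi>] L_value_nonzero[OF sf, of \<chi>] by (auto split: if_splits)
  qed
  then obtain K where K: "norm (mangoldt_sum_upto \<chi> x - of_bool (\<chi> = principal_char M) * of_real (ln x)) \<le> K \<chi>"
    if "\<chi> \<in> dchars M" "x > 0" for \<chi> x by metis
  define h where "h = card (dchars M)"
  have "ln (real x) \<le> h * (4 + (\<Sum>p\<in>?P. mangoldt p / p)) + (\<Sum>\<chi>\<in>dchars M. K \<chi>)" if x: "x > 0" for x :: nat
  proof -
    let ?T = "\<Sum>n | n \<in> {1..x} \<and> [b * n = 1] (mod M). mangoldt n / n :: real"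
    have "(\<Sum>\<chi>\<in>dchars M. \<chi> b * (of_bool (\<chi> = principal_char M) * of_real (ln x))) =
        (\<Sum>\<chi>\<in>dchars M. if \<chi> = principal_char M then complex_of_real (ln x) else 0)"
      using b by (intro sum.cong refl) (simp add: principal_char_def)
    also have "\<dots> = of_real (ln x)"
      using finite_dchars[OF M] principal_in_dchars[OF M] by simp
    finally have eq: "of_real (h * ?T - ln x) =
        (\<Sum>\<chi>\<in>dchars M. \<chi> b * (mangoldt_sum_upto \<chi> x - of_bool (\<chi> = principal_char M) * of_real (ln x)))"
      using sum_dchars_mangoldt_sum_upto[OF sf b, of x]
      by (simp only: right_diff_distrib sum_subtractf h_def of_real_diff)
    have "norm (complex_of_real (h * ?T - ln x)) \<le> (\<Sum>\<chi>\<in>dchars M. K \<chi>)"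
      unfolding eq by (intro sum_norm_le) (simp add: norm_mult norm_dchars[OF _ M b] K[OF _ x])
    then have "\<bar>h * ?T - ln x\<bar> \<le> (\<Sum>\<chi>\<in>dchars M. K \<chi>)" by (simp only: norm_of_real)
    moreover have "?T \<le> 4 + (\<Sum>p\<in>?P. mangoldt p / p)"
    proof -
      have "[n = a] (mod M)" if "[b * n = 1] (mod M)" for n
      proof -
        have "[b * n = b * a] (mod M)" using that ab by (metis cong_sym cong_trans mult.commute)
        then show ?thesis using b cong_mult_lcancel_nat by blast
      qed
      then have "?T \<le> (\<Sum>n\<in>{n. n \<in> {1..x} \<and> \<not> prime n} \<union> ?P. mangoldt n / n)"
        using fin by (intro sum_mono2) (auto intro!: divide_nonneg_nonneg mangoldt_nonneg)
      also have "\<dots> = (\<Sum>n\<in>{n. n \<in> {1..x} \<and> \<not> prime n}. mangoldt n / n) + (\<Sum>p\<in>?P. mangoldt p / p)"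
        using fin by (intro sum.union_disjoint) auto
      finally show ?thesis using sum_mangoldt_nonprime_le[of x] by simp
    qed
    then have "h * ?T \<le> h * (4 + (\<Sum>p\<in>?P. mangoldt p / p))" by (intro mult_left_mono) auto
    ultimately show ?thesis by linarith
  qed
  moreover obtain x :: nat where
    "x > 0" "ln (real x) > h * (4 + (\<Sum>p\<in>?P. mangoldt p / p)) + (\<Sum>\<chi>\<in>dchars M. K \<chi>)"
    by (rule exists_ln_greater)
  ultimately show False using not_less by blast
qed

section \<open>The covering congruence\<close>

lemma odd_prime_factor_exists:
  assumes "m > (0::nat)" "\<not> (\<exists>k. m = 2 ^ k)"
  obtains l where "prime l" "l dvd m" "l \<noteq> 2"
proof -
  have "\<exists>l. prime l \<and> l dvd m \<and> l \<noteq> 2"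
  proof (rule ccontr)
    assume "\<not> ?thesis"
    then have "prime_factors m \<subseteq> {2}" by (auto simp: in_prime_factors_iff)
    then have "(\<Prod>p\<in>prime_factors m. p ^ multiplicity p m) = (\<Prod>p\<in>{2}. p ^ multiplicity p m)"
      by (intro prod.mono_neutral_left) (auto simp: prime_factors_multiplicity)
    then have "m = 2 ^ multiplicity 2 m"
      using prime_factorization_nat[OF assms(1)] by simp
    with assms(2) show False by blast
  qed
  then show ?thesis using that by blast
qed

text \<open>Modulo \<open>l\<close> the power \<open>q ^ 2 ^ j\<close> is -1, which differs from 1
  as \<open>l\<close> is odd; its square is 1.\<close>

lemma ord_of_odd_prime_factor:
  assumes "prime (l::nat)" "l \<noteq> 2" "l dvd q ^ 2 ^ j + 1"
  shows "ord l q = 2 ^ Suc j"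
proof -
  have minus: "[q ^ 2 ^ j + 1 = 0] (mod l)" using assms(3) by (simp add: cong_0_iff)
  have "\<not> [q ^ 2 ^ j = 1] (mod l)"
  proof
    assume "[q ^ 2 ^ j = 1] (mod l)"
    then have "[q ^ 2 ^ j + 1 = 1 + 1] (mod l)" by (intro cong_add) auto
    with minus have "[1 + 1 = 0] (mod l)" using cong_trans cong_sym by blast
    then have "l dvd 2" by (simp add: cong_0_iff numeral_2_eq_2)
    with assms show False by (simp add: primes_dvd_imp_eq)
  qed
  then have not_dvd: "\<not> ord l q dvd 2 ^ j" using ord_divides by blast
  have "[q ^ 2 ^ Suc j = 1] (mod l)"
  proof -
    have "int l dvd int (q ^ 2 ^ j + 1)" using assms(3) by (subst int_dvd_int_iff)
    then have "int l dvd (int q ^ 2 ^ j + 1) * (int q ^ 2 ^ j - 1)" by (simp add: add.commute)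
    also have "(int q ^ 2 ^ j + 1) * (int q ^ 2 ^ j - 1) = int (q ^ 2 ^ Suc j) - int 1"
      by (simp add: algebra_simps power_mult power2_eq_square)
    finally show ?thesis by (simp add: cong_int_iff[symmetric] cong_iff_dvd_diff)
  qed
  then have "ord l q dvd 2 ^ Suc j" using ord_divides by blast
  then obtain i where i: "i \<le> Suc j" "ord l q = 2 ^ i"
    using divides_primepow_nat[OF two_is_prime_nat] by blast
  have "\<not> i \<le> j"
    using not_dvd i(2) le_imp_power_dvd by metis
  with i show ?thesis by (simp add: le_Suc_eq)
qed

text \<open>It suffices that \<open>q ^ 2 ^ j + 1\<close> is not a power of 2. For
  \<open>j = 0\<close> this is the assumption on \<open>q + 1\<close>; for larger \<open>j\<close>
  the number is a square plus 1, at least 5 and not divisible by 4.\<close>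

lemma prime_of_two_power_ord_exists:
  assumes "q \<ge> (2::nat)" "\<not> (\<exists>k. q + 1 = 2 ^ k)"
  shows "\<exists>l. prime l \<and> ord l q = 2 ^ Suc j"
proof -
  have "\<not> (\<exists>k. q ^ 2 ^ j + 1 = 2 ^ k)"
  proof (cases j)
    case 0
    then show ?thesis using assms(2) by simp
  next
    case (Suc i)
    define x where "x = q ^ 2 ^ i"
    have "q ^ 1 \<le> x" unfolding x_def using assms(1) by (intro power_increasing) auto
    then have "2 * 2 \<le> x * x" using assms(1) by (intro mult_le_mono) auto
    moreover have "q ^ 2 ^ j = x * x" by (simp add: Suc x_def power_mult power2_eq_square power_mult_distrib)
    moreover have False if "x * x + 1 = 2 ^ k" "2 * 2 \<le> x * x" for k
    proof (cases "k \<le> 1")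
      case True
      then have "(2::nat) ^ k \<le> 2 ^ 1" by (intro power_increasing) auto
      then show False using that by simp
    next
      case False
      then have "(4::nat) dvd 2 ^ k" using le_imp_power_dvd[of 2 k "2::nat"] by simp
      moreover have "\<not> 4 dvd x * x + 1"
      proof (cases "even x")
        case True
        then obtain y where "x = 2 * y" by blast
        then have "x * x + 1 = 4 * (y * y) + 1" by simp
        then show ?thesis by presburger
      next
        case False
        then obtain y where "x = 2 * y + 1" using oddE by blast
        then have "x * x + 1 = 4 * (y * y + y) + 2" by (simp add: algebra_simps)
        then show ?thesis by presburger
      qed
      ultimately show False using that(1) by metis
    qed
    ultimately show ?thesis by metis
  qed
  then obtain l where "prime l" "l dvd q ^ 2 ^ j + 1" "l \<noteq> 2"
    using odd_prime_factor_exists[of "q ^ 2 ^ j + 1"] by auto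
  then show ?thesis using ord_of_odd_prime_factor by blast
qed

text \<open>Index 0 handles exponents divisible by \<open>2 ^ N\<close>; index \<open>Suc i\<close>
  handles those exactly divisible by \<open>2 ^ i\<close>, which are congruent to
  \<open>2 ^ i\<close> modulo \<open>2 ^ Suc i\<close>.\<close>

lemma power_cover:
  fixes l :: "nat \<Rightarrow> nat"
  assumes "coprime (l 0) q" "ord (l 0) q = 2 ^ N"
    and "\<And>i. i < N \<Longrightarrow> coprime (l (Suc i)) q \<and> ord (l (Suc i)) q = 2 ^ Suc i"
  shows "[q ^ j = 1] (mod l 0) \<or> (\<exists>i<N. [q ^ j = q ^ 2 ^ i] (mod l (Suc i)))"
proof (cases "2 ^ N dvd j")
  case True
  then show ?thesis using assms(2) ord_divides by metis
next
  case False
  then have "j \<noteq> 0" by (metis dvd_0_right)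
  then obtain w where w: "j = 2 ^ multiplicity 2 j * w" "\<not> 2 dvd w"
    using multiplicity_decompose'[of j 2] by auto
  define v where "v = multiplicity 2 j"
  have "v < N"
  proof (rule ccontr)
    assume "\<not> v < N"
    then have "2 ^ N dvd (2::nat) ^ v" by (simp add: le_imp_power_dvd)
    then have "2 ^ N dvd j" using w(1) v_def by (metis dvd_mult2)
    with False show False by simp
  qed
  obtain s where "w = 2 * s + 1" using w(2) oddE by blast
  then have "j = 2 ^ v + 2 ^ Suc v * s" using w(1) by (simp add: v_def algebra_simps)
  then have "[j = 2 ^ v] (mod 2 ^ Suc v)" by (simp add: cong_def)
  then have "[q ^ j = q ^ 2 ^ v] (mod l (Suc v))"
    using order_divides_expdiff assms(3)[OF \<open>v < N\<close>] by metis
  with \<open>v < N\<close> show ?thesis by blast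
qed

lemma prime_power_mult_in_G:
  assumes q: "prime (r + 1)" and p: "prime p" "p > r + 1"
    and comp: "\<And>j. \<not> prime ((r + 1) ^ j * p + r)" and ne: "\<And>j. p \<noteq> (r + 1) ^ j + r"
  shows "(r + 1) ^ \<alpha> * p \<in> G r"
proof -
  have "schemmel r n \<noteq> (r + 1) ^ \<alpha> * p" if "n > 0" for n
  proof
    assume eq: "schemmel r n = (r + 1) ^ \<alpha> * p"
    define F where "F l = (if l \<le> r then 0 else l ^ (multiplicity l n - 1) * (l - r))" for l
    have prod: "(\<Prod>l\<in>prime_factors n. F l) = (r + 1) ^ \<alpha> * p"
      using eq by (simp add: schemmel_def F_def)
    then have "p dvd (\<Prod>l\<in>prime_factors n. F l)" by simp
    then obtain l where l: "l \<in> prime_factors n" "p dvd F l"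
      using prime_dvd_prod_iff[of "prime_factors n" p F] p(1) by auto
    have dvd: "F l dvd (r + 1) ^ \<alpha> * p"
      unfolding prod[symmetric] using l(1) by (intro dvd_prodI) auto
    have "r < l"
    proof (rule ccontr)
      assume "\<not> r < l"
      then have "F l = 0" by (simp add: F_def)
      with dvd p(2) show False by simp
    qed
    have pl: "prime l" using l(1) by auto
    \<comment> \<open>A cofactor of \<open>p\<close> in a divisor of
      \<open>(r + 1) ^ \<alpha> * p\<close> divides a power of the prime
      \<open>r + 1\<close>.\<close>
    have power: "\<exists>j. m = (r + 1) ^ j" if "p * m dvd (r + 1) ^ \<alpha> * p" for m
    proof -
      have "m dvd (r + 1) ^ \<alpha>" using that p(2) by (simp add: mult.commute[of p])
      then show ?thesis using divides_primepow_nat[OF q] by blast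
    qed
    have F: "F l = l ^ (multiplicity l n - 1) * (l - r)" using \<open>r < l\<close> by (simp add: F_def)
    from l(2) consider "p dvd l ^ (multiplicity l n - 1)" | "p dvd l - r"
      unfolding F using p(1) prime_dvd_mult_iff by blast
    then show False
    proof cases
      case 1
      then have "p = l" using p(1) pl prime_dvd_power primes_dvd_imp_eq by blast
      have "p * (l - r) dvd F l" unfolding F using 1 by (intro mult_dvd_mono) auto
      with dvd obtain j where "l - r = (r + 1) ^ j" using power dvd_trans by blast
      then have "p = (r + 1) ^ j + r" using \<open>p = l\<close> \<open>r < l\<close> by simp
      with ne show False by blast
    next
      case 2
      then obtain m where m: "l - r = p * m" by blast
      then have "p * m dvd F l" unfolding F by simp
      with dvd obtain j where "m = (r + 1) ^ j" using power dvd_trans by blast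
      then have "l = (r + 1) ^ j * p + r" using m \<open>r < l\<close> by (simp add: mult.commute)
      with comp pl show False by blast
    qed
  qed
  then have "(r + 1) ^ \<alpha> * p \<notin> schemmel r ` {n. n > 0}" by (metis imageE mem_Collect_eq)
  then show ?thesis using p by (simp add: G_def)
qed

theorem theorem2p1:
  fixes r :: nat
  assumes "r > 0"
    and "prime (r + 1)"
    and "\<not> (\<exists>k. r + 2 = 2 ^ k)"
    and "\<exists>N p1 p2. N > 0 \<and> prime p1 \<and> prime p2 \<and> p1 \<noteq> p2 \<and>
            ord p1 (r + 1) = 2 ^ N \<and> ord p2 (r + 1) = 2 ^ N"
  shows "infinite {p. prime p \<and> (\<forall>\<alpha>::nat. (r + 1) ^ \<alpha> * p \<in> G r)}"
proof -
  define q where "q = r + 1"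
  obtain N p1 p2 where N: "N > 0" and p12: "prime p1" "prime p2" "p1 \<noteq> p2"
    and ord12: "ord p1 q = 2 ^ N" "ord p2 q = 2 ^ N"
    using assms(4) unfolding q_def by blast
  have q2: "q \<ge> 2" using assms(1) by (simp add: q_def)
  have "\<forall>j. \<exists>l. prime l \<and> ord l q = 2 ^ Suc j"
    using prime_of_two_power_ord_exists[OF q2] assms(3) by (simp add: q_def)
  then obtain f where f: "prime (f j)" "ord (f j) q = 2 ^ Suc j" for j by metis
  \<comment> \<open>Index \<open>0\<close> is the second prime of order \<open>2\<^sup>N\<close>, responsible for the exponents divisible by \<open>2\<^sup>N\<close>.\<close>
  define l where "l i = (if i = 0 then p2 else if i = N then p1 else f (i - 1))" for i
  \<comment> \<open>\<open>2 ^ e i\<close> is the order of \<open>q\<close> modulo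
    \<open>l i\<close>, and \<open>c i\<close> represents the class of exponents that index
    \<open>i\<close> covers.\<close>
  define e where "e i = (if i = 0 then N else i)" for i
  define c where "c i = (if i = 0 then 0 else 2 ^ (i - 1) :: nat)" for i
  have l: "prime (l i)" "ord (l i) q = 2 ^ e i" for i
  proof -
    have "Suc (i - 1) = i" if "i \<noteq> 0" using that by simp
    then have "prime (l i) \<and> ord (l i) q = 2 ^ e i"
      using p12 ord12 f[of "i - 1"] unfolding l_def e_def by presburger
    then show "prime (l i)" "ord (l i) q = 2 ^ e i" by blast+
  qed
  \<comment> \<open>Equal primes give equal orders, which leaves only the indices 0 and
    \<open>N\<close>, where \<open>p2\<close> and \<open>p1\<close> differ.\<close>
  have inj: "l i \<noteq> l j" if "i \<in> {..N}" "j \<in> {..N}" "i \<noteq> j" for i j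
  proof
    assume eq: "l i = l j"
    then have "(2::nat) ^ e i = 2 ^ e j" using l(2) by metis
    then have "e i = e j" by simp
    then show False using that eq p12(3) N by (auto simp: e_def l_def split: if_splits)
  qed
  have cop: "coprime (l i) q" for i
    using l(2)[of i] by (metis ord_gt_0_iff zero_less_numeral zero_less_power)
  have "\<exists>u. l i dvd q ^ c i * u + r" for i
  proof -
    have "coprime (q ^ c i) (l i)" using cop[of i] by (simp add: coprime_commute)
    then obtain v where v: "[q ^ c i * v = 1] (mod l i)"
      using cong_solve_coprime_nat by (metis One_nat_def)
    \<comment> \<open>The factor \<open>r * (l i - 1)\<close> stands for \<open>- r\<close> in the
      naturals; multiplied by the inverse \<open>v\<close>, it is the required residue.\<close>
    have "[q ^ c i * v * (r * (l i - 1)) + r = 1 * (r * (l i - 1)) + r] (mod l i)"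
      by (intro cong_add cong_mult v cong_refl)
    also have "1 * (r * (l i - 1)) + r = r * l i"
      using prime_gt_0_nat[OF l(1)[of i]] by (cases "l i") auto
    finally have "l i dvd q ^ c i * (v * (r * (l i - 1))) + r"
      by (simp add: cong_dvd_iff mult.assoc)
    then show ?thesis by blast
  qed
  then obtain u where u: "l i dvd q ^ c i * u i + r" for i by metis
  have "\<forall>i\<in>{..N}. \<forall>j\<in>{..N}. i \<noteq> j \<longrightarrow> coprime (l i) (l j)"
    using inj l(1) primes_coprime by blast
  from chinese_remainder_nat[OF finite_atMost this, of u]
  obtain a where a: "\<And>i. i \<in> {..N} \<Longrightarrow> [a = u i] (mod l i)" by blast
  define M where "M = (\<Prod>i\<le>N. l i)"
  have lM: "l i dvd M" if "i \<in> {..N}" for i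
    unfolding M_def using that by (intro dvd_prodI) auto
  have sol: "l i dvd q ^ c i * n + r" if "i \<in> {..N}" "[n = a] (mod M)" for i n
  proof -
    have "[n = u i] (mod l i)"
      using that a lM cong_dvd_modulus_nat cong_trans by blast
    then have "[q ^ c i * n + r = q ^ c i * u i + r] (mod l i)"
      by (intro cong_add cong_mult cong_refl)
    then show ?thesis using u cong_dvd_iff by blast
  qed
  have "squarefree M"
    unfolding M_def using inj l(1)
    by (intro squarefree_prod_coprime) (auto intro: primes_coprime squarefree_prime)
  \<comment> \<open>If \<open>l i\<close> divided \<open>a\<close>, it would divide
    \<open>r = q - 1\<close>, and \<open>q\<close> would have order 1 instead of
    \<open>2 ^ e i\<close> with \<open>e i > 0\<close>.\<close>
  moreover have "coprime a M"
    unfolding M_def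
  proof (rule prod_coprime_right)
    fix i assume i: "i \<in> {..N}"
    have "\<not> l i dvd a"
    proof
      assume "l i dvd a"
      then have "l i dvd r" using sol[OF i, of a] by (simp add: dvd_add_right_iff)
      then have "[r + 1 = 0 + 1] (mod l i)" by (intro cong_add) (simp_all add: cong_0_iff)
      then have "[q = 1] (mod l i)" by (simp add: q_def)
      then have "ord (l i) q = 1" using ord_eq_Suc_0_iff by simp
      then have "e i = 0" using l(2)[of i] by simp
      then show False using N by (auto simp: e_def split: if_splits)
    qed
    then show "coprime a (l i)" using l(1)[of i] prime_imp_coprime coprime_commute by blast
  qed
  ultimately have "infinite {p. prime p \<and> [p = a] (mod M)}"
    by (rule dirichlet_primes_squarefree_modulus)
  \<comment> \<open>Requiring \<open>p > M\<close> makes each covering prime a proper divisor of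
    \<open>q ^ j * p + r\<close>.\<close>
  then have "infinite ({p. prime p \<and> [p = a] (mod M)} - {..M + q})" by simp
  moreover have "{p. prime p \<and> [p = a] (mod M)} - {..M + q} \<subseteq>
      {p. prime p \<and> (\<forall>\<alpha>::nat. (r + 1) ^ \<alpha> * p \<in> G r)}"
  proof
    fix p assume "p \<in> {p. prime p \<and> [p = a] (mod M)} - {..M + q}"
    then have p: "prime p" "[p = a] (mod M)" "p > M" "p > q" by auto
    have "\<not> prime (q ^ j * p + r)" for j
    proof -
      have "[q ^ j = 1] (mod l 0) \<or> (\<exists>i<N. [q ^ j = q ^ 2 ^ i] (mod l (Suc i)))"
        by (rule power_cover) (use cop l(2) in \<open>simp_all add: e_def\<close>)
      then obtain i where i: "i \<in> {..N}" "[q ^ j = q ^ c i] (mod l i)"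
      proof
        assume "[q ^ j = 1] (mod l 0)"
        then show ?thesis using that[of 0] by (simp add: c_def)
      next
        assume "\<exists>i<N. [q ^ j = q ^ 2 ^ i] (mod l (Suc i))"
        then obtain i where "i < N" "[q ^ j = q ^ 2 ^ i] (mod l (Suc i))" by blast
        then show ?thesis using that[of "Suc i"] by (simp add: c_def)
      qed
      have "[q ^ j * p + r = q ^ c i * p + r] (mod l i)"
        by (intro cong_add cong_mult i(2) cong_refl)
      then have "l i dvd q ^ j * p + r"
        using sol[OF i(1) p(2)] cong_dvd_iff by blast
      moreover have "l i \<le> M"
        using lM[OF i(1)] l(1) by (intro dvd_imp_le) (auto simp: M_def intro!: prod_pos prime_gt_0_nat)
      moreover have "p \<le> q ^ j * p" using q2 by simp
      ultimately show ?thesis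
        using p(3) l(1)[of i] by (metis primes_dvd_imp_eq le_trans le_add1 not_le)
    qed
    \<comment> \<open>The prime \<open>l 1\<close> divides \<open>q * p + r\<close>. For
      \<open>p = q ^ j + r\<close> this number is \<open>q ^ Suc j + r * (q + 1)\<close>, and
      \<open>l 1\<close> divides \<open>r * (q + 1) = q^2 - 1\<close>, so it would divide a power of
      \<open>q\<close>.\<close>
    moreover have "p \<noteq> q ^ j + r" for j
    proof
      assume eq: "p = q ^ j + r"
      have l1: "ord (l 1) q = 2" using l(2)[of 1] by (simp add: e_def)
      have "[q ^ 2 = 1] (mod l 1)" using ord_divides[of q 2 "l 1"] l1 by simp
      then have "l 1 dvd q ^ 2 - 1" using q2 by (metis cong_to_1_nat)
      also have "q ^ 2 - 1 = r * (q + 1)" by (simp add: q_def power2_eq_square)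
      finally have "l 1 dvd r * (q + 1)" .
      moreover have "l 1 dvd q ^ Suc j + r * (q + 1)"
        using sol[OF _ p(2), of 1] N by (simp add: c_def eq algebra_simps)
      ultimately have "l 1 dvd q ^ Suc j" by (simp add: dvd_add_left_iff)
      then have "l 1 dvd q" using l(1) prime_dvd_power by blast
      then show False using cop[of 1] l(1)[of 1] by (metis coprime_absorb_left not_prime_unit)
    qed
    ultimately have "(r + 1) ^ \<alpha> * p \<in> G r" for \<alpha>
      using assms(2) p by (intro prime_power_mult_in_G) (auto simp: q_def)
    then show "p \<in> {p. prime p \<and> (\<forall>\<alpha>::nat. (r + 1) ^ \<alpha> * p \<in> G r)}" using p(1) by blast
  qed
  ultimately show ?thesis using infinite_super by blast
qed

end
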